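(* Let $q:(0,\infty)\to(0,\infty)$ be an increasing function with $\lim_{x\to\infty}q(x)=\infty$. Then there exist $g\in H^\infty(\mathbb{D})$ such that $g(\mathbb{D})\cap\mathbb{D}=\varnothing$, the boundary function of $g$ is $C^\infty$ on $\mathbb{T}$, and for $z\in\mathbb{T}$ one has $|g(z)|=1$ if and only if $z=1$, together with a non-zero $f\in H^2(\mathbb{D})$, such that the inequality $\|(T_g^* )^nf\|<q(n)$ holds for infinitely many $n\in\mathbb{N}$.
   Context: $\mathbb{D}$ is the open unit disk, $\mathbb{T}$ the unit circle; $H^\infty$ functions are identified with their boundary values on $\mathbb{T}$. $H^2(\mathbb{D})\subseteq L^2(\mathbb{T})$; for $g\in L^\infty(\mathbb{T})$, $T_g=PM_g$ with $M_g$ multiplication by $g$ and $P$ the orthogonal projection of $L^2(\mathbb{T})$ onto $H^2(\mathbb{D})$; $T_g^*$ is the Hilbert space adjoint. *)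

theory Defs
  imports "HOL-Complex_Analysis.Complex_Analysis"
begin

definition taylor_coeff :: "(complex \<Rightarrow> complex) \<Rightarrow> nat \<Rightarrow> complex" where
  "taylor_coeff f n = (deriv ^^ n) f 0 / of_nat (fact n)"

definition H2 :: "(complex \<Rightarrow> complex) set" where
  "H2 = {f. f holomorphic_on ball 0 1 \<and> summable (\<lambda>n. (cmod (taylor_coeff f n))\<^sup>2)}"

definition H2_inner :: "(complex \<Rightarrow> complex) \<Rightarrow> (complex \<Rightarrow> complex) \<Rightarrow> complex" where
  "H2_inner u v = (\<Sum>n. taylor_coeff u n * cnj (taylor_coeff v n))"

definition H2_norm :: "(complex \<Rightarrow> complex) \<Rightarrow> real" where
  "H2_norm f = sqrt (\<Sum>n. (cmod (taylor_coeff f n))\<^sup>2)"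

definition Hinf :: "(complex \<Rightarrow> complex) set" where
  "Hinf = {g. g holomorphic_on ball 0 1 \<and> bounded (g ` ball 0 1)}"

text \<open>Toeplitz operator T_g = P M_g on H^2; for g in H^infinity, g*f already lies in H^2,
  so P acts as the identity.\<close>
definition toeplitz :: "(complex \<Rightarrow> complex) \<Rightarrow> (complex \<Rightarrow> complex) \<Rightarrow> (complex \<Rightarrow> complex)" where
  "toeplitz g f = (\<lambda>z. g z * f z)"

definition is_toeplitz_adjoint ::
  "(complex \<Rightarrow> complex) \<Rightarrow> ((complex \<Rightarrow> complex) \<Rightarrow> (complex \<Rightarrow> complex)) \<Rightarrow> bool" where
  "is_toeplitz_adjoint g A \<longleftrightarrow>
     (\<forall>h\<in>H2. A h \<in> H2) \<and>
     (\<forall>u\<in>H2. \<forall>h\<in>H2. H2_inner (toeplitz g u) h = H2_inner u (A h))"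

definition vderiv :: "(real \<Rightarrow> complex) \<Rightarrow> real \<Rightarrow> complex" where
  "vderiv h = (\<lambda>t. vector_derivative h (at t))"

definition C_infinity :: "(real \<Rightarrow> complex) \<Rightarrow> bool" where
  "C_infinity h \<longleftrightarrow> (\<forall>k t. ((vderiv ^^ k) h) differentiable (at t))"

end

theory Submission
  imports Defs
begin

text \<open>
  In terms of Taylor coefficients the adjoint of \<open>T\<^sub>g\<close> is
  \<open>(x\<^sub>m) \<mapsto> (\<Sum>n. cnj g\<^sub>n * x\<^sub>m\<^sub>+\<^sub>n)\<close>, and it sends the Fourier coefficients of a function \<open>\<phi>\<close> on
  an arc to those of \<open>\<phi> * cnj g\<close>. Hence if \<open>g = exp w\<close> with \<open>Re w = 0\<close> on an arc around 1, every
  vector of Fourier coefficients of a function supported in that arc has a bounded orbit, and such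
  vectors are dense. Starting from \<open>w = 0\<close> one adds, with rapidly decreasing weights, countably many
  smooth bumps \<open>\<psi>\<^sub>k\<close> with \<open>Re \<psi>\<^sub>k \<ge> 0\<close> that vanish near 1 and together cover the rest of the circle,
  and each time perturbs the vector slightly so that its orbit is bounded again. After each
  step some \<open>n\<close> is fixed for which the orbit bound lies below \<open>q n\<close>, and all later changes are
  kept so small that this inequality survives in the limit.

  The bumps are infinite convolutions of the Poisson kernel with normalised indicator functions of
  intervals, so that their Taylor coefficients are products of values of the sinc function.
\<close>

section \<open>Square-summable sequences\<close>

text \<open>The obstacle is that |g| > 1 off the single point 1, so the limit function is unimodular
  on no arc and the source of bounded orbits is lost in the limit. Only infinitely many n, one per
  stage, can be kept. Since the n-th power magnifies a change of w by a factor exponential in n, n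
  must be fixed first, from the bounded orbit of its stage alone, and the admissible size of all
  later changes is chosen afterwards in terms of n. Writing g as an exponential helps twice:
  nonnegative real parts add up, so |g| >= 1 persists, and g^n = exp (n w) turns a small change of w
  into a factor close to 1. Density has the classical reason that an H^2 function vanishing on an
  arc is 0. Here it is replaced by an explicit estimate: a multiplier of modulus 1 off the arc and
  of value exp N at 0 makes the rest of the circle negligible. Smoothness of the limit is secured by
  normalising the k-th bump in the weighted coefficient norms of orders 0 to k, so that each fixed
  norm is controlled for all but finitely many k.\<close>

definition l2_bounded :: "(nat \<Rightarrow> complex) \<Rightarrow> real \<Rightarrow> bool" where
  "l2_bounded x C \<longleftrightarrow> (\<forall>M. L2_set (\<lambda>n. cmod (x n)) {..<M} \<le> C)"

lemma l2_bounded_nonneg: "l2_bounded x C \<Longrightarrow> 0 \<le> C"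
  unfolding l2_bounded_def by (drule spec[of _ 0]) simp

lemma l2_bounded_mono: "l2_bounded x C \<Longrightarrow> C \<le> D \<Longrightarrow> l2_bounded x D"
  unfolding l2_bounded_def by (meson order_trans)

lemma l2_bounded_zero: "l2_bounded (\<lambda>n. 0) 0"
  by (simp add: l2_bounded_def L2_set_def)

lemma l2_bounded_add:
  assumes "l2_bounded x C" "l2_bounded y D"
  shows "l2_bounded (\<lambda>n. x n + y n) (C + D)"
  unfolding l2_bounded_def
proof
  fix M
  have "L2_set (\<lambda>n. cmod (x n + y n)) {..<M} \<le> L2_set (\<lambda>n. cmod (x n) + cmod (y n)) {..<M}"
    by (rule L2_set_mono) (auto intro: norm_triangle_ineq)
  also have "\<dots> \<le> L2_set (\<lambda>n. cmod (x n)) {..<M} + L2_set (\<lambda>n. cmod (y n)) {..<M}"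
    by (rule L2_set_triangle_ineq)
  also have "\<dots> \<le> C + D" using assms unfolding l2_bounded_def by (meson add_mono)
  finally show "L2_set (\<lambda>n. cmod (x n + y n)) {..<M} \<le> C + D" .
qed

lemma l2_bounded_scale:
  assumes "l2_bounded x C"
  shows "l2_bounded (\<lambda>n. c * x n) (cmod c * C)"
  unfolding l2_bounded_def
proof
  fix M
  have "L2_set (\<lambda>n. cmod (c * x n)) {..<M} = cmod c * L2_set (\<lambda>n. cmod (x n)) {..<M}"
    by (simp add: norm_mult L2_set_right_distrib)
  also have "\<dots> \<le> cmod c * C" using assms unfolding l2_bounded_def by (simp add: mult_left_mono)
  finally show "L2_set (\<lambda>n. cmod (c * x n)) {..<M} \<le> cmod c * C" .
qed

lemma l2_bounded_diff:
  assumes "l2_bounded x C" "l2_bounded y D"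
  shows "l2_bounded (\<lambda>n. x n - y n) (C + D)"
  using l2_bounded_add[OF assms(1) l2_bounded_scale[OF assms(2), of "-1"]] by simp

text \<open>Lower semicontinuity of the norm: every finite section depends continuously on finitely
  many coefficients. This is why \<open>l2_bounded\<close> bounds finite sections instead of a
  series; convergence need not be known beforehand.\<close>

lemma l2_bounded_limit:
  assumes "F \<noteq> bot" "\<And>n. ((\<lambda>k. x k n) \<longlongrightarrow> y n) F" "(C \<longlongrightarrow> D) F"
    and "eventually (\<lambda>k. l2_bounded (x k) (C k)) F"
  shows "l2_bounded y D"
  unfolding l2_bounded_def
proof
  fix M
  have "((\<lambda>k. L2_set (\<lambda>n. cmod (x k n)) {..<M}) \<longlongrightarrow> L2_set (\<lambda>n. cmod (y n)) {..<M}) F"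
    unfolding L2_set_def by (intro tendsto_intros assms)
  moreover have "eventually (\<lambda>k. L2_set (\<lambda>n. cmod (x k n)) {..<M} \<le> C k) F"
    using assms(4) by eventually_elim (auto simp: l2_bounded_def)
  ultimately show "L2_set (\<lambda>n. cmod (y n)) {..<M} \<le> D"
    using tendsto_le[OF assms(1) assms(3)] by blast
qed

lemma l2_bounded_sqrt_iff: "l2_bounded x C \<longleftrightarrow> 0 \<le> C \<and> (\<forall>M. (\<Sum>n<M. (cmod (x n))\<^sup>2) \<le> C\<^sup>2)"
proof
  assume h: "l2_bounded x C"
  have C: "0 \<le> C" using h by (rule l2_bounded_nonneg)
  have "(\<Sum>n<M. (cmod (x n))\<^sup>2) \<le> C\<^sup>2" for M
  proof -
    have "sqrt (\<Sum>n<M. (cmod (x n))\<^sup>2) \<le> C" using h by (simp add: l2_bounded_def L2_set_def)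
    then show ?thesis by (rule sqrt_le_D)
  qed
  then show "0 \<le> C \<and> (\<forall>M. (\<Sum>n<M. (cmod (x n))\<^sup>2) \<le> C\<^sup>2)" using C by blast
next
  assume "0 \<le> C \<and> (\<forall>M. (\<Sum>n<M. (cmod (x n))\<^sup>2) \<le> C\<^sup>2)"
  then show "l2_bounded x C" by (auto simp: l2_bounded_def L2_set_def intro: real_le_lsqrt sum_nonneg)
qed

lemma l2_bounded_summable:
  assumes "l2_bounded x C"
  shows "summable (\<lambda>n. (cmod (x n))\<^sup>2)"
  by (rule summableI_nonneg_bounded) (use assms in \<open>auto simp: l2_bounded_sqrt_iff\<close>)

lemma l2_bounded_suminf_le:
  assumes "l2_bounded x C"
  shows "sqrt (\<Sum>n. (cmod (x n))\<^sup>2) \<le> C"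
  using assms l2_bounded_summable[OF assms]
  by (intro real_le_lsqrt suminf_nonneg) (auto simp: l2_bounded_sqrt_iff intro: suminf_le_const)

lemma summable_l2_bounded:
  assumes "summable (\<lambda>n. (cmod (x n))\<^sup>2)"
  shows "l2_bounded x (sqrt (\<Sum>n. (cmod (x n))\<^sup>2))"
  using assms by (auto simp: l2_bounded_sqrt_iff suminf_nonneg intro: sum_le_suminf)

lemma l2_bounded_norm_le: "l2_bounded x C \<Longrightarrow> cmod (x n) \<le> C"
proof -
  assume h: "l2_bounded x C"
  have "cmod (x n) \<le> L2_set (\<lambda>n. cmod (x n)) {..<Suc n}"
    by (rule member_le_L2_set) auto
  also have "\<dots> \<le> C" using h by (simp add: l2_bounded_def)
  finally show ?thesis .
qed

lemma l2_bounded_truncate: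
  assumes "l2_bounded x C"
  shows "l2_bounded (\<lambda>n. if n < M then x n else 0) C"
proof -
  have "(\<Sum>n<N. (cmod (if n < M then x n else 0))\<^sup>2) \<le> (\<Sum>n<N. (cmod (x n))\<^sup>2)" for N
    by (rule sum_mono) auto
  then show ?thesis using assms unfolding l2_bounded_sqrt_iff by (meson order_trans)
qed

lemma l2_bounded_tail:
  assumes "l2_bounded x C" "e > 0"
  shows "\<exists>M0. \<forall>M\<ge>M0. l2_bounded (\<lambda>n. if n < M then 0 else x n) e"
proof -
  let ?s = "\<lambda>n. (cmod (x n))\<^sup>2"
  have sm: "summable ?s" by (rule l2_bounded_summable) fact
  have "(\<lambda>M. (\<Sum>n. ?s n) - (\<Sum>n<M. ?s n)) \<longlonglongrightarrow> (\<Sum>n. ?s n) - (\<Sum>n. ?s n)"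
    by (intro tendsto_intros summable_LIMSEQ sm)
  then have "eventually (\<lambda>M. (\<Sum>n. ?s n) - (\<Sum>n<M. ?s n) < e\<^sup>2) sequentially"
    using assms(2) by (intro order_tendstoD) auto
  then obtain M0 where M0: "\<And>M. M \<ge> M0 \<Longrightarrow> (\<Sum>n. ?s n) - (\<Sum>n<M. ?s n) < e\<^sup>2"
    by (auto simp: eventually_sequentially)
  have "l2_bounded (\<lambda>n. if n < M then 0 else x n) e" if M: "M \<ge> M0" for M
    unfolding l2_bounded_sqrt_iff
  proof (intro conjI allI)
    fix N
    \<comment> \<open>The range is enlarged to \<open>M + N\<close> so that it contains the whole
      head \<open>{..<M}\<close>, which can then be subtracted exactly.\<close>
    have "(\<Sum>n<N. (cmod (if n < M then 0 else x n))\<^sup>2) \<le> (\<Sum>n<M+N. (cmod (if n < M then 0 else x n))\<^sup>2)"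
      by (rule sum_mono2) auto
    also have "\<dots> = (\<Sum>n<M+N. ?s n - (if n < M then ?s n else 0))" by (rule sum.cong) auto
    also have "\<dots> = (\<Sum>n<M+N. ?s n) - (\<Sum>n<M+N. if n < M then ?s n else 0)" by (rule sum_subtractf)
    also have "(\<Sum>n<M+N. if n < M then ?s n else 0) = (\<Sum>n<M. ?s n)"
      by (rule sum.mono_neutral_cong_right) auto
    also have "(\<Sum>n<M+N. ?s n) - (\<Sum>n<M. ?s n) \<le> (\<Sum>n. ?s n) - (\<Sum>n<M. ?s n)"
      using sm by (intro diff_right_mono sum_le_suminf) auto
    also have "\<dots> \<le> e\<^sup>2" using M0[OF M] by simp
    finally show "(\<Sum>n<N. (cmod (if n < M then 0 else x n))\<^sup>2) \<le> e\<^sup>2" .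
  qed (use assms in auto)
  then show ?thesis by blast
qed

lemma l2_bounded_shift:
  assumes "l2_bounded x C"
  shows "l2_bounded (\<lambda>n. x (m + n)) C"
proof -
  have "(\<Sum>n<M. (cmod (x (m + n)))\<^sup>2) \<le> (\<Sum>n<m+M. (cmod (x n))\<^sup>2)" for M
  proof -
    have "(\<Sum>n<M. (cmod (x (m + n)))\<^sup>2) = (\<Sum>n\<in>{m..<m+M}. (cmod (x n))\<^sup>2)"
      by (rule sum.reindex_bij_witness[of _ "\<lambda>n. n - m" "\<lambda>n. m + n"]) auto
    also have "\<dots> \<le> (\<Sum>n<m+M. (cmod (x n))\<^sup>2)" by (rule sum_mono2) auto
    finally show ?thesis .
  qed
  then show ?thesis using assms unfolding l2_bounded_sqrt_iff by (meson order_trans)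
qed

lemma l2_bounded_mult_sum_le:
  assumes "l2_bounded x C" "l2_bounded y D"
  shows "(\<Sum>n<M. cmod (x n) * cmod (y n)) \<le> C * D"
proof -
  have "(\<Sum>n<M. cmod (x n) * cmod (y n)) \<le> L2_set (\<lambda>n. cmod (x n)) {..<M} * L2_set (\<lambda>n. cmod (y n)) {..<M}"
    using L2_set_mult_ineq[of "\<lambda>n. cmod (x n)" "\<lambda>n. cmod (y n)" "{..<M}"] by simp
  also have "\<dots> \<le> C * D"
    using assms l2_bounded_nonneg[OF assms(1)] by (intro mult_mono) (auto simp: l2_bounded_def)
  finally show ?thesis .
qed

lemma l2_bounded_mult_summable:
  assumes "l2_bounded x C" "l2_bounded y D"
  shows "summable (\<lambda>n. cmod (x n) * cmod (y n))"
  by (rule summableI_nonneg_bounded[where x = "C * D"]) (use l2_bounded_mult_sum_le[OF assms] in auto)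

section \<open>Fourier coefficients on an arc\<close>

text \<open>Fourier coefficients of \<phi> extended by 0 beyond the arc; keeping only m >= 0 is the
  projection onto H^2. Integrating over the arc alone keeps the integrands continuous although the
  extension may jump at the endpoints.\<close>

definition arc_coeff :: "real \<Rightarrow> real \<Rightarrow> (real \<Rightarrow> complex) \<Rightarrow> nat \<Rightarrow> complex" where
  "arc_coeff a b \<phi> m = integral {a..b} (\<lambda>t. \<phi> t * cis (- real m * t)) / (2 * pi)"

lemma continuous_on_cis_mult [continuous_intros]: "continuous_on S (\<lambda>t. cis (c * t))"
  unfolding cis_conv_exp by (intro continuous_intros)

lemma continuous_on_cis_id: "continuous_on S cis"
  unfolding cis_conv_exp by (intro continuous_intros)

lemma integral_cis:
  assumes "k \<noteq> (0::int)"
  shows "integral {a..a + 2 * pi} (\<lambda>t. cis (real_of_int k * t)) = 0"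
proof -
  let ?F = "\<lambda>t. cis (real_of_int k * t) / (\<i> * of_int k)"
  have "((\<lambda>t. cis (real_of_int k * t)) has_integral (?F (a + 2 * pi) - ?F a)) {a..a + 2 * pi}"
  proof (rule fundamental_theorem_of_calculus)
    fix t :: real
    have "((\<lambda>z. exp (\<i> * of_int k * z) / (\<i> * of_int k)) has_field_derivative
        exp (\<i> * of_int k * of_real t)) (at (of_real t))"
      using assms by (auto intro!: derivative_eq_intros)
    from has_vector_derivative_real_field[OF this]
    show "(?F has_vector_derivative cis (real_of_int k * t)) (at t within {a..a + 2 * pi})"
      by (simp add: cis_conv_exp mult.assoc has_vector_derivative_at_within)
  qed simp
  moreover have "cis (real_of_int k * (a + 2 * pi)) = cis (real_of_int k * a)"
  proof -
    have "cis (real_of_int k * (a + 2 * pi)) = cis (real_of_int k * a) * cis (2 * pi * real_of_int k)"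
      by (simp add: cis_mult algebra_simps)
    then show ?thesis by (simp add: cis_multiple_2pi)
  qed
  ultimately have "((\<lambda>t. cis (real_of_int k * t)) has_integral 0) {a..a + 2 * pi}" by simp
  then show ?thesis by (rule integral_unique)
qed

text \<open>The starting point of the period stays free: both [0, 2 pi] and the period starting at
  -\<theta>, which splits into an arc and its complement, are used below.\<close>

lemma arc_coeff_circle_cis:
  assumes "b = a + 2 * pi"
  shows "arc_coeff a b (\<lambda>t. cis (real M * t)) m = (if m = M then 1 else 0)"
proof (cases "m = M")
  case True
  then show ?thesis using assms by (simp add: arc_coeff_def cis_mult scaleR_conv_of_real)
next
  case False
  have "arc_coeff a b (\<lambda>t. cis (real M * t)) m
      = integral {a..a+2*pi} (\<lambda>t. cis (real_of_int (int M - int m) * t)) / (2 * pi)"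
    unfolding arc_coeff_def assms cis_mult by (simp add: left_diff_distrib)
  also have "\<dots> = 0" using False by (subst integral_cis) auto
  finally show ?thesis using False by simp
qed

lemma arc_coeff_integrable:
  assumes "continuous_on {a..b} \<phi>"
  shows "(\<lambda>t. \<phi> t * cis (- real m * t)) integrable_on {a..b}"
  by (intro integrable_continuous_real continuous_intros assms)

lemma arc_coeff_add:
  assumes "continuous_on {a..b} \<phi>" "continuous_on {a..b} \<psi>"
  shows "arc_coeff a b (\<lambda>t. \<phi> t + \<psi> t) m = arc_coeff a b \<phi> m + arc_coeff a b \<psi> m"
  unfolding arc_coeff_def distrib_right add_divide_distrib[symmetric]
  by (subst Henstock_Kurzweil_Integration.integral_add[OF arc_coeff_integrable[OF assms(1)] arc_coeff_integrable[OF assms(2)]]) (rule refl)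

lemma arc_coeff_scale: "arc_coeff a b (\<lambda>t. c * \<phi> t) m = c * arc_coeff a b \<phi> m"
  unfolding arc_coeff_def mult.assoc by (simp only: integral_mult_right times_divide_eq_right)

lemma arc_coeff_sum:
  assumes "finite I" "\<And>i. i \<in> I \<Longrightarrow> continuous_on {a..b} (\<phi> i)"
  shows "arc_coeff a b (\<lambda>t. \<Sum>i\<in>I. \<phi> i t) m = (\<Sum>i\<in>I. arc_coeff a b (\<phi> i) m)"
  using assms
proof (induction I rule: finite_induct)
  case empty
  then show ?case by (simp add: arc_coeff_def)
next
  case (insert i I)
  then have "continuous_on {a..b} (\<lambda>t. \<Sum>i\<in>I. \<phi> i t)" by (intro continuous_on_sum) auto
  moreover have "continuous_on {a..b} (\<phi> i)" using insert by simp
  ultimately show ?case using insert by (simp add: arc_coeff_add)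
qed

lemma arc_coeff_split:
  assumes "a \<le> b" "b \<le> c" "continuous_on {a..c} \<phi>"
  shows "arc_coeff a c \<phi> m = arc_coeff a b \<phi> m + arc_coeff b c \<phi> m"
proof -
  have "(\<lambda>t. \<phi> t * cis (- real m * t)) integrable_on {a..c}" by (rule arc_coeff_integrable) fact
  from Henstock_Kurzweil_Integration.integral_combine[OF assms(1,2) this]
  show ?thesis unfolding arc_coeff_def add_divide_distrib[symmetric] by (simp only:)
qed

lemma integral_norm_trig_poly:
  fixes c :: "nat \<Rightarrow> complex"
  shows "integral {a..a+2*pi} (\<lambda>t. (cmod (\<Sum>m<M. c m * cis (real m * t)))\<^sup>2) = 2 * pi * (\<Sum>m<M. (cmod (c m))\<^sup>2)"
proof -
  let ?S = "\<lambda>t. \<Sum>m<M. c m * cis (real m * t)"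
  let ?b = "a + 2 * pi"
  have cont: "continuous_on {a..?b} ?S" by (intro continuous_intros)
  have cS: "arc_coeff a ?b ?S m = (if m < M then c m else 0)" for m
  proof -
    have "arc_coeff a ?b ?S m = (\<Sum>k<M. arc_coeff a ?b (\<lambda>t. c k * cis (real k * t)) m)"
      by (rule arc_coeff_sum) (auto intro!: continuous_intros)
    also have "\<dots> = (\<Sum>k<M. if k = m then c k else 0)"
      by (rule sum.cong) (auto simp: arc_coeff_scale arc_coeff_circle_cis)
    finally show ?thesis by simp
  qed
  have "complex_of_real (integral {a..?b} (\<lambda>t. (cmod (?S t))\<^sup>2)) = integral {a..?b} (\<lambda>t. complex_of_real ((cmod (?S t))\<^sup>2))"
    by (intro integral_unique[symmetric] has_integral_of_real integrable_integral integrable_continuous_real continuous_intros)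
  also have "(\<lambda>t. complex_of_real ((cmod (?S t))\<^sup>2)) = (\<lambda>t. \<Sum>m<M. cnj (c m) * (?S t * cis (- real m * t)))"
  proof
    fix t
    have "complex_of_real ((cmod (?S t))\<^sup>2) = ?S t * cnj (?S t)" by (rule complex_norm_square)
    also have "cnj (?S t) = (\<Sum>m<M. cnj (c m) * cis (- real m * t))" by (simp add: cis_cnj)
    also have "?S t * \<dots> = (\<Sum>m<M. cnj (c m) * (?S t * cis (- real m * t)))"
      by (subst sum_distrib_left) (simp only: mult_ac)
    finally show "complex_of_real ((cmod (?S t))\<^sup>2) = (\<Sum>m<M. cnj (c m) * (?S t * cis (- real m * t)))" .
  qed
  also have "integral {a..?b} (\<lambda>t. \<Sum>m<M. cnj (c m) * (?S t * cis (- real m * t)))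
      = (\<Sum>m<M. cnj (c m) * integral {a..?b} (\<lambda>t. ?S t * cis (- real m * t)))"
    by (subst integral_sum) (auto intro!: integrable_continuous_real continuous_intros)
  also have "\<dots> = (\<Sum>m<M. cnj (c m) * (2 * pi * arc_coeff a ?b ?S m))" by (simp add: arc_coeff_def)
  also have "\<dots> = complex_of_real (2 * pi * (\<Sum>m<M. (cmod (c m))\<^sup>2))"
    by (simp only: cS of_real_mult of_real_sum complex_norm_square sum_distrib_left)
      (auto intro!: sum.cong simp: mult_ac)
  finally show ?thesis by (simp only: of_real_eq_iff)
qed

text \<open>Expand the integral over the arc of |\<phi> - S|^2, with S the trigonometric polynomial
  built from the first M coefficients. The cross term is exact, and the |S|^2 term is estimated by
  its integral over a full period, where Parseval applies; hence the bound on the length of the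
  arc.\<close>

lemma bessel:
  assumes "b \<le> a + 2 * pi" "continuous_on {a..b} \<phi>"
  shows "l2_bounded (arc_coeff a b \<phi>) (sqrt (integral {a..b} (\<lambda>t. (cmod (\<phi> t))\<^sup>2) / (2 * pi)))"
proof -
  let ?I = "integral {a..b} (\<lambda>t. (cmod (\<phi> t))\<^sup>2)"
  have I0: "0 \<le> ?I" by (rule integral_nonneg) (auto intro!: integrable_continuous_real continuous_intros assms)
  have "(\<Sum>n<M. (cmod (arc_coeff a b \<phi> n))\<^sup>2) \<le> ?I / (2 * pi)" for M
  proof -
    define c where "c = arc_coeff a b \<phi>"
    define S where "S = (\<lambda>t. \<Sum>m<M. c m * cis (real m * t))"
    define s where "s = (\<Sum>n<M. (cmod (c n))\<^sup>2)"
    have contS: "continuous_on X S" for X unfolding S_def by (intro continuous_intros)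
    have "integral {a..b} (\<lambda>t. (cmod (S t))\<^sup>2) \<le> integral {a..a+2*pi} (\<lambda>t. (cmod (S t))\<^sup>2)"
      by (rule integral_subset_le) (auto intro!: integrable_continuous_real continuous_intros contS simp: assms(1) order_trans[OF _ assms(1)])
    also have "\<dots> = 2 * pi * s" unfolding S_def s_def by (rule integral_norm_trig_poly)
    finally have 1: "integral {a..b} (\<lambda>t. (cmod (S t))\<^sup>2) \<le> 2 * pi * s" .
    have 2: "integral {a..b} (\<lambda>t. \<phi> t * cnj (S t)) = complex_of_real (2 * pi * s)"
    proof -
      have "(\<lambda>t. \<phi> t * cnj (S t)) = (\<lambda>t. \<Sum>m<M. cnj (c m) * (\<phi> t * cis (- real m * t)))"
        by (rule ext) (simp add: S_def sum_distrib_left mult_ac cis_cnj)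
      then have "integral {a..b} (\<lambda>t. \<phi> t * cnj (S t)) = (\<Sum>m<M. cnj (c m) * integral {a..b} (\<lambda>t. \<phi> t * cis (- real m * t)))"
        by (simp only:) (subst integral_sum, auto intro!: integrable_continuous_real continuous_intros assms)
      also have "\<dots> = (\<Sum>m<M. cnj (c m) * (2 * pi * c m))" by (simp add: arc_coeff_def c_def)
      also have "\<dots> = complex_of_real (2 * pi * s)"
        by (simp only: s_def of_real_mult of_real_sum complex_norm_square sum_distrib_left)
          (auto intro!: sum.cong simp: mult_ac)
      finally show ?thesis .
    qed
    have 3: "integral {a..b} (\<lambda>t. Re (\<phi> t * cnj (S t))) = 2 * pi * s"
    proof -
      have "(\<lambda>t. \<phi> t * cnj (S t)) integrable_on {a..b}"
        by (intro integrable_continuous_real continuous_intros contS assms)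
      from integral_linear[OF this bounded_linear_Re] 2 show ?thesis by (simp add: o_def)
    qed
    have "0 \<le> integral {a..b} (\<lambda>t. (cmod (\<phi> t - S t))\<^sup>2)"
      by (rule integral_nonneg) (auto intro!: integrable_continuous_real continuous_intros contS assms)
    also have "(\<lambda>t. (cmod (\<phi> t - S t))\<^sup>2) = (\<lambda>t. (cmod (\<phi> t))\<^sup>2 - 2 * Re (\<phi> t * cnj (S t)) + (cmod (S t))\<^sup>2)"
      by (rule ext) (simp add: cmod_power2, simp add: power2_eq_square algebra_simps)
    also have "integral {a..b} \<dots> = ?I - 2 * (2 * pi * s) + integral {a..b} (\<lambda>t. (cmod (S t))\<^sup>2)"
      by (subst Henstock_Kurzweil_Integration.integral_add, (intro integrable_continuous_real continuous_intros contS assms)+,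
          subst Henstock_Kurzweil_Integration.integral_diff, (intro integrable_continuous_real continuous_intros contS assms)+)
        (simp only: 3 integral_mult_right)
    finally have "2 * pi * s \<le> ?I" using 1 by linarith
    then have "s \<le> ?I / (2 * pi)" by (simp add: field_simps)
    then show ?thesis by (simp add: s_def c_def)
  qed
  then show ?thesis using I0 by (simp add: l2_bounded_sqrt_iff)
qed

lemma bessel_sup:
  assumes "a \<le> b" "b \<le> a + 2 * pi" "continuous_on {a..b} \<phi>" "\<And>t. t \<in> {a..b} \<Longrightarrow> cmod (\<phi> t) \<le> K" "0 \<le> K"
  shows "l2_bounded (arc_coeff a b \<phi>) K"
proof (rule l2_bounded_mono[OF bessel[OF assms(2,3)]])
  have "integral {a..b} (\<lambda>t. (cmod (\<phi> t))\<^sup>2) \<le> integral {a..b} (\<lambda>t. K\<^sup>2)"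
    by (rule integral_le) (auto intro!: integrable_continuous_real continuous_intros assms power_mono)
  also have "\<dots> \<le> 2 * pi * K\<^sup>2" using assms(1,2) by (simp add: mult_right_mono)
  finally show "sqrt (integral {a..b} (\<lambda>t. (cmod (\<phi> t))\<^sup>2) / (2 * pi)) \<le> K"
    using assms(5) by (intro real_le_lsqrt) (simp_all add: field_simps)
qed

lemma arc_coeff_mult_le:
  assumes "b \<le> a + 2 * pi" "continuous_on {a..b} \<phi>" "continuous_on {a..b} h"
    and "\<And>t. t \<in> {a..b} \<Longrightarrow> cmod (h t) \<le> K" "0 \<le> K"
  shows "l2_bounded (arc_coeff a b (\<lambda>t. \<phi> t * h t)) (K * sqrt (integral {a..b} (\<lambda>t. (cmod (\<phi> t))\<^sup>2) / (2 * pi)))"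
proof (rule l2_bounded_mono[OF bessel[OF assms(1)]])
  show "continuous_on {a..b} (\<lambda>t. \<phi> t * h t)" by (intro continuous_intros assms)
  have "integral {a..b} (\<lambda>t. (cmod (\<phi> t * h t))\<^sup>2) \<le> integral {a..b} (\<lambda>t. K\<^sup>2 * (cmod (\<phi> t))\<^sup>2)"
  proof (rule integral_le)
    fix t assume "t \<in> {a..b}"
    then have "(cmod (h t))\<^sup>2 \<le> K\<^sup>2" using assms(4) by (simp add: power_mono)
    then show "(cmod (\<phi> t * h t))\<^sup>2 \<le> K\<^sup>2 * (cmod (\<phi> t))\<^sup>2"
      by (metis mult.commute mult_right_mono norm_mult power_mult_distrib zero_le_power2)
  qed (intro integrable_continuous_real continuous_intros assms)+
  also have "\<dots> = K\<^sup>2 * integral {a..b} (\<lambda>t. (cmod (\<phi> t))\<^sup>2)" by simp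
  finally have "integral {a..b} (\<lambda>t. (cmod (\<phi> t * h t))\<^sup>2) / (2 * pi) \<le> K\<^sup>2 * (integral {a..b} (\<lambda>t. (cmod (\<phi> t))\<^sup>2) / (2 * pi))"
    by (simp add: divide_right_mono)
  then have "sqrt (integral {a..b} (\<lambda>t. (cmod (\<phi> t * h t))\<^sup>2) / (2 * pi)) \<le> sqrt (K\<^sup>2 * (integral {a..b} (\<lambda>t. (cmod (\<phi> t))\<^sup>2) / (2 * pi)))"
    by (rule real_sqrt_le_mono)
  also have "\<dots> = K * sqrt (integral {a..b} (\<lambda>t. (cmod (\<phi> t))\<^sup>2) / (2 * pi))"
    using assms(5) by (simp only: real_sqrt_mult real_sqrt_abs abs_of_nonneg)
  finally show "sqrt (integral {a..b} (\<lambda>t. (cmod (\<phi> t * h t))\<^sup>2) / (2 * pi)) \<le> K * sqrt (integral {a..b} (\<lambda>t. (cmod (\<phi> t))\<^sup>2) / (2 * pi))" .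
qed

lemma arc_coeff_tendsto:
  assumes "F \<noteq> bot" "\<And>k. continuous_on {a..b} (\<phi> k)" "uniform_limit {a..b} \<phi> \<psi> F"
  shows "((\<lambda>k. arc_coeff a b (\<phi> k) m) \<longlongrightarrow> arc_coeff a b \<psi> m) F"
proof -
  have "continuous_on {a..b} \<psi>"
    by (rule uniform_limit_theorem[OF _ assms(3) assms(1)]) (simp add: assms(2))
  then have "uniform_limit {a..b} (\<lambda>k t. \<phi> k t * cis (- real m * t)) (\<lambda>t. \<psi> t * cis (- real m * t)) F"
    by (intro uniform_lim_mult assms uniform_limit_const)
      (auto intro!: compact_imp_bounded compact_continuous_image continuous_intros)
  then obtain I J where I: "\<And>k. ((\<lambda>t. \<phi> k t * cis (- real m * t)) has_integral I k) {a..b}"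
    and J: "((\<lambda>t. \<psi> t * cis (- real m * t)) has_integral J) {a..b}" and "(I \<longlongrightarrow> J) F"
    by (rule uniform_limit_integral) (auto intro!: continuous_intros assms)
  then have "((\<lambda>k. integral {a..b} (\<lambda>t. \<phi> k t * cis (- real m * t))) \<longlongrightarrow> integral {a..b} (\<lambda>t. \<psi> t * cis (- real m * t))) F"
    by (simp only: integral_unique[OF I] integral_unique[OF J])
  then show ?thesis unfolding arc_coeff_def by (intro tendsto_divide tendsto_const) auto
qed

text \<open>On the circle the conjugate of z^n is z^(-n), which moves coefficient m + n to place m.
  Absolute summability gives uniform convergence of the multiplier, hence termwise
  integration.\<close>

lemma arc_coeff_mult_cnj_series:
  assumes "continuous_on {a..b} \<phi>" "summable (\<lambda>n. cmod (c n))"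
  shows "(\<lambda>n. cnj (c n) * arc_coeff a b \<phi> (m + n)) sums arc_coeff a b (\<lambda>t. \<phi> t * cnj (\<Sum>n. c n * cis (real n * t))) m"
proof -
  let ?\<phi> = "\<lambda>N t. \<phi> t * cnj (\<Sum>n<N. c n * cis (real n * t))"
  have ul: "uniform_limit {a..b} (\<lambda>N t. \<Sum>n<N. c n * cis (real n * t)) (\<lambda>t. \<Sum>n. c n * cis (real n * t)) sequentially"
    by (rule Weierstrass_m_test) (auto simp: norm_mult assms(2))
  then have ul': "uniform_limit {a..b} (\<lambda>N t. cnj (\<Sum>n<N. c n * cis (real n * t))) (\<lambda>t. cnj (\<Sum>n. c n * cis (real n * t))) sequentially"
    by (rule bounded_linear.uniform_limit[OF bounded_linear_cnj])
  have cs: "continuous_on {a..b} (\<lambda>t. \<Sum>n. c n * cis (real n * t))"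
    by (rule uniform_limit_theorem[OF _ ul]) (auto intro!: always_eventually continuous_intros)
  have "uniform_limit {a..b} ?\<phi> (\<lambda>t. \<phi> t * cnj (\<Sum>n. c n * cis (real n * t))) sequentially"
    by (intro uniform_lim_mult ul' uniform_limit_const)
      (auto intro!: compact_imp_bounded compact_continuous_image continuous_intros assms cs)
  then have "(\<lambda>N. arc_coeff a b (?\<phi> N) m) \<longlonglongrightarrow> arc_coeff a b (\<lambda>t. \<phi> t * cnj (\<Sum>n. c n * cis (real n * t))) m"
    by (intro arc_coeff_tendsto) (auto intro!: continuous_intros assms)
  moreover have "arc_coeff a b (?\<phi> N) m = (\<Sum>n<N. cnj (c n) * arc_coeff a b \<phi> (m + n))" for N
  proof -
    have "?\<phi> N = (\<lambda>t. \<Sum>n<N. cnj (c n) * (\<phi> t * cis (- real n * t)))"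
      by (rule ext) (simp add: sum_distrib_left mult_ac cis_cnj)
    then have "arc_coeff a b (?\<phi> N) m = (\<Sum>n<N. arc_coeff a b (\<lambda>t. cnj (c n) * (\<phi> t * cis (- real n * t))) m)"
      by (simp only:) (rule arc_coeff_sum, auto intro!: continuous_intros assms)
    also have "\<dots> = (\<Sum>n<N. cnj (c n) * arc_coeff a b \<phi> (m + n))"
      by (intro sum.cong refl) (simp only: arc_coeff_scale, simp add: arc_coeff_def mult.assoc cis_mult algebra_simps)
    finally show ?thesis .
  qed
  ultimately show ?thesis unfolding sums_def by simp
qed

section \<open>The adjoint Toeplitz operator on coefficients\<close>

lemma taylor_sums:
  assumes "g holomorphic_on ball 0 1" "cmod z < 1"
  shows "(\<lambda>n. taylor_coeff g n * z ^ n) sums g z"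
  using holomorphic_power_series[OF assms(1), of z] assms(2) by (simp add: taylor_coeff_def)

lemma taylor_abs_summable:
  assumes "g holomorphic_on ball 0 1" "0 \<le> r" "r < 1"
  shows "summable (\<lambda>n. cmod (taylor_coeff g n) * r ^ n)"
proof -
  \<comment> \<open>Any radius strictly between r and 1 works: convergence there forces absolute
    convergence at r.\<close>
  let ?z = "complex_of_real ((1 + r) / 2)"
  have "cmod ?z < 1" unfolding norm_of_real using assms by (simp add: abs_if)
  then have "summable (\<lambda>n. taylor_coeff g n * ?z ^ n)"
    using taylor_sums[OF assms(1)] by (blast intro: sums_summable)
  then have "summable (\<lambda>n. norm (taylor_coeff g n * complex_of_real r ^ n))"
    by (rule powser_insidea) (unfold norm_of_real, use assms in \<open>simp add: abs_if\<close>)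
  then show ?thesis using assms by (simp add: norm_mult norm_power)
qed

lemma taylor_unique:
  assumes "\<And>z. cmod z < 1 \<Longrightarrow> (\<lambda>n. c n * z ^ n) sums g z"
  shows "g holomorphic_on ball 0 1" "taylor_coeff g = c"
proof -
  show "g holomorphic_on ball 0 1"
    by (rule power_series_holomorphic[where a = c]) (use assms in auto)
  have pser: "eventually (\<lambda>z. (\<lambda>n. fps_nth (Abs_fps c) n * z ^ n) sums g z) (nhds 0)"
    using eventually_nhds_in_open[of "ball (0::complex) 1" 0] by (auto elim!: eventually_mono intro: assms)
  have "fps_expansion g 0 = Abs_fps c"
    by (rule fps_expansion_eqI) (rule has_fps_expansionI[OF pser])
  then have "fps_nth (fps_expansion g 0) n = c n" for n by simp
  then show "taylor_coeff g = c" by (auto simp: fps_expansion_def taylor_coeff_def)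
qed

lemma taylor_coeff_0 [simp]: "taylor_coeff g 0 = g 0"
  by (simp add: taylor_coeff_def)

lemma taylor_coeff_diff:
  assumes "g holomorphic_on ball 0 1" "h holomorphic_on ball 0 1"
  shows "taylor_coeff (\<lambda>z. g z - h z) n = taylor_coeff g n - taylor_coeff h n"
proof -
  have "taylor_coeff (\<lambda>z. g z - h z) = (\<lambda>n. taylor_coeff g n - taylor_coeff h n)"
    by (rule taylor_unique) (use taylor_sums assms in \<open>auto simp: left_diff_distrib intro!: sums_diff\<close>)
  then show ?thesis by simp
qed

text \<open>For finitely supported \<open>x\<close> this is a finite sum; for square-summable
  \<open>x\<close> and bounded g it converges absolutely by
  \<open>adj_op_abs_summable\<close>.\<close>

definition adj_op :: "(complex \<Rightarrow> complex) \<Rightarrow> (nat \<Rightarrow> complex) \<Rightarrow> nat \<Rightarrow> complex" where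
  "adj_op g x m = (\<Sum>n. cnj (taylor_coeff g n) * x (m + n))"

lemma adj_op_finite:
  assumes "\<And>n. n \<ge> M \<Longrightarrow> x n = 0"
  shows "adj_op g x m = (\<Sum>n<M. cnj (taylor_coeff g n) * x (m + n))"
  unfolding adj_op_def by (rule suminf_finite) (auto simp: assms)

text \<open>Dilating to g (r z) makes the Taylor series absolutely summable on the circle, which
  boundedness of g alone need not provide. For finitely supported \<open>x\<close> the sequence then
  consists of coefficients of a trigonometric polynomial times a function of modulus at most K, so
  Bessel and Parseval give the bound.\<close>

lemma adj_op_finite_le_strict:
  assumes g: "g holomorphic_on ball 0 1" "\<And>z. cmod z < 1 \<Longrightarrow> cmod (g z) \<le> K"
    and x: "\<And>n. n \<ge> M \<Longrightarrow> x n = 0" "l2_bounded x C" and r: "0 \<le> r" "r < 1"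
  shows "l2_bounded (\<lambda>m. \<Sum>n<M. cnj (taylor_coeff g n * of_real r ^ n) * x (m + n)) (K * C)"
proof -
  define \<phi> where "\<phi> = (\<lambda>t. \<Sum>n<M. x n * cis (real n * t))"
  have c\<phi>: "continuous_on S \<phi>" for S unfolding \<phi>_def by (intro continuous_intros)
  have K: "0 \<le> K" using g(2)[of 0] norm_ge_zero[of "g 0"] by (simp del: norm_ge_zero)
  have gr: "cmod (of_real r * cis t) < 1" for t using r by (simp add: norm_mult)
  have cx: "arc_coeff 0 (2 * pi) \<phi> m = x m" for m
  proof -
    have "arc_coeff 0 (2 * pi) \<phi> m = (\<Sum>k<M. arc_coeff 0 (2 * pi) (\<lambda>t. x k * cis (real k * t)) m)"
      unfolding \<phi>_def by (rule arc_coeff_sum) (auto intro!: continuous_intros)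
    also have "\<dots> = (\<Sum>k<M. if k = m then x k else 0)"
      by (rule sum.cong) (auto simp: arc_coeff_scale arc_coeff_circle_cis)
    finally show ?thesis using x(1)[of m] by (auto simp: not_less)
  qed
  have sm: "summable (\<lambda>n. cmod (taylor_coeff g n * of_real r ^ n))"
    using taylor_abs_summable[OF g(1) r] r by (simp add: norm_mult norm_power)
  have gs: "(\<Sum>n. taylor_coeff g n * of_real r ^ n * cis (real n * t)) = g (of_real r * cis t)" for t
    using sums_unique[OF taylor_sums[OF g(1) gr, of t]]
    by (simp add: power_mult_distrib Complex.DeMoivre mult.assoc)
  have sms: "(\<lambda>n. cnj (taylor_coeff g n * of_real r ^ n) * x (m + n)) sums
      arc_coeff 0 (2 * pi) (\<lambda>t. \<phi> t * cnj (g (of_real r * cis t))) m" for m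
    using arc_coeff_mult_cnj_series[OF c\<phi> sm, of 0 "2 * pi" m] by (simp only: gs cx)
  have eq: "(\<Sum>n<M. cnj (taylor_coeff g n * of_real r ^ n) * x (m + n))
      = arc_coeff 0 (2 * pi) (\<lambda>t. \<phi> t * cnj (g (of_real r * cis t))) m" for m
    by (rule sums_unique2[OF sums_finite sms]) (auto simp: x)
  have cg: "continuous_on {0..2 * pi} (\<lambda>t. cnj (g (of_real r * cis t)))"
    by (intro continuous_intros continuous_on_compose2[OF holomorphic_on_imp_continuous_on[OF g(1)]] continuous_on_cis_id)
      (use gr in auto)
  have "l2_bounded (arc_coeff 0 (2 * pi) (\<lambda>t. \<phi> t * cnj (g (of_real r * cis t))))
     (K * sqrt (integral {0..2 * pi} (\<lambda>t. (cmod (\<phi> t))\<^sup>2) / (2 * pi)))"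
    by (rule arc_coeff_mult_le) (use c\<phi> cg g(2) gr K in auto)
  moreover have "sqrt (integral {0..2 * pi} (\<lambda>t. (cmod (\<phi> t))\<^sup>2) / (2 * pi)) \<le> C"
    using integral_norm_trig_poly[of 0 x M] x(2) unfolding \<phi>_def by (simp add: l2_bounded_def L2_set_def)
  ultimately show ?thesis unfolding eq using K by (auto elim!: l2_bounded_mono intro: mult_left_mono)
qed

text \<open>Each coefficient is a finite sum, so r can tend to 1 termwise, while the bound,
  independent of r, survives by semicontinuity.\<close>

lemma adj_op_finite_le:
  assumes g: "g holomorphic_on ball 0 1" "\<And>z. cmod z < 1 \<Longrightarrow> cmod (g z) \<le> K"
    and x: "\<And>n. n \<ge> M \<Longrightarrow> x n = 0" "l2_bounded x C"
  shows "l2_bounded (adj_op g x) (K * C)"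
proof (rule l2_bounded_limit[where F = "at_left (1::real)" and C = "\<lambda>_. K * C"])
  fix m
  have "((\<lambda>r::real. \<Sum>n<M. cnj (taylor_coeff g n * of_real r ^ n) * x (m + n)) \<longlongrightarrow>
      (\<Sum>n<M. cnj (taylor_coeff g n * of_real 1 ^ n) * x (m + n))) (at_left 1)"
    by (intro tendsto_intros)
  then show "((\<lambda>r::real. \<Sum>n<M. cnj (taylor_coeff g n * of_real r ^ n) * x (m + n)) \<longlongrightarrow> adj_op g x m) (at_left 1)"
    by (simp add: adj_op_finite[OF x(1)])
  have "eventually (\<lambda>r::real. r \<in> {0<..<1}) (at_left 1)" by (rule eventually_at_left_real) simp
  then show "eventually (\<lambda>r::real. l2_bounded (\<lambda>m. \<Sum>n<M. cnj (taylor_coeff g n * of_real r ^ n) * x (m + n)) (K * C)) (at_left 1)"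
    by eventually_elim (rule adj_op_finite_le_strict[OF g x], auto)
qed auto

lemma l2_bounded_delta: "l2_bounded (\<lambda>n. if n = M then 1 else 0) 1"
proof -
  have "(\<Sum>n<N. (cmod (if n = M then 1 else 0))\<^sup>2) = (\<Sum>n<N. if n = M then 1 else 0)" for N
    by (rule sum.cong) auto
  then show ?thesis by (simp add: l2_bounded_sqrt_iff)
qed

lemma adj_op_delta:
  "adj_op g (\<lambda>n. if n = M then 1 else 0) m = (if m \<le> M then cnj (taylor_coeff g (M - m)) else 0)"
proof -
  have "adj_op g (\<lambda>n. if n = M then 1 else 0) m = (\<Sum>n<Suc M. if m \<le> M \<and> n = M - m then cnj (taylor_coeff g (M - m)) else 0)"
    by (subst adj_op_finite[of "Suc M"]) (auto intro!: sum.cong)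
  also have "\<dots> = (if m \<le> M then cnj (taylor_coeff g (M - m)) else 0)" by (auto simp: sum.delta less_Suc_eq_le)
  finally show ?thesis .
qed

text \<open>The adjoint applied to the M-th unit vector lists the conjugated coefficients of g from
  M down to 0, with a bound K independent of M. The resulting square-summability is what makes
  \<open>adj_op\<close> meaningful on infinite sequences, so it has to precede
  \<open>adj_op_le\<close>.\<close>

lemma l2_bounded_taylor:
  assumes g: "g holomorphic_on ball 0 1" "\<And>z. cmod z < 1 \<Longrightarrow> cmod (g z) \<le> K"
  shows "l2_bounded (taylor_coeff g) K"
proof -
  have b: "l2_bounded (adj_op g (\<lambda>n. if n = M then 1 else 0)) (K * 1)" for M
    by (rule adj_op_finite_le[OF g _ l2_bounded_delta, where M = "Suc M"]) auto
  have "(\<Sum>n<N. (cmod (taylor_coeff g n))\<^sup>2) \<le> K\<^sup>2" for N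
  proof -
    have "(\<Sum>n<N. (cmod (taylor_coeff g n))\<^sup>2) = (\<Sum>n<N. (cmod (taylor_coeff g (N - Suc n)))\<^sup>2)"
      by (rule sum.nat_diff_reindex[symmetric])
    also have "\<dots> \<le> (\<Sum>n<N. (cmod (adj_op g (\<lambda>n. if n = N - 1 then 1 else 0) n))\<^sup>2)"
      by (rule sum_mono) (auto simp: adj_op_delta)
    also have "\<dots> \<le> K\<^sup>2" using b[of "N - 1"] unfolding l2_bounded_sqrt_iff by simp
    finally show ?thesis .
  qed
  then show ?thesis using l2_bounded_nonneg[OF b] by (simp add: l2_bounded_sqrt_iff)
qed

lemma adj_op_abs_summable:
  assumes g: "g holomorphic_on ball 0 1" "\<And>z. cmod z < 1 \<Longrightarrow> cmod (g z) \<le> K" and x: "l2_bounded x C"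
  shows "summable (\<lambda>n. cmod (cnj (taylor_coeff g n) * x (m + n)))"
  using l2_bounded_mult_summable[OF l2_bounded_taylor[OF g] l2_bounded_shift[OF x, of m]] by (simp add: norm_mult)

lemma adj_op_le:
  assumes g: "g holomorphic_on ball 0 1" "\<And>z. cmod z < 1 \<Longrightarrow> cmod (g z) \<le> K" and x: "l2_bounded x C"
  shows "l2_bounded (adj_op g x) (K * C)"
proof (rule l2_bounded_limit[where F = sequentially and C = "\<lambda>_. K * C"])
  fix m
  let ?x = "\<lambda>M n. if n < M then x n else 0"
  have sm: "summable (\<lambda>n. cnj (taylor_coeff g n) * x (m + n))"
    by (rule summable_norm_cancel) (rule adj_op_abs_summable[OF assms])
  \<comment> \<open>Truncating \<open>x\<close> at M leaves exactly the first \<open>M - m\<close>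
    terms of the m-th series, none if M <= m, as natural subtraction says.\<close>
  have "adj_op g (?x M) m = (\<Sum>n<M - m. cnj (taylor_coeff g n) * x (m + n))" for M
  proof -
    have "adj_op g (?x M) m = (\<Sum>n<M. cnj (taylor_coeff g n) * ?x M (m + n))" by (rule adj_op_finite) auto
    also have "\<dots> = (\<Sum>n<M - m. cnj (taylor_coeff g n) * x (m + n))"
      by (rule sum.mono_neutral_cong_right) auto
    finally show ?thesis .
  qed
  moreover have "(\<lambda>M. \<Sum>n<M - m. cnj (taylor_coeff g n) * x (m + n)) \<longlonglongrightarrow> adj_op g x m"
    unfolding adj_op_def by (rule filterlim_compose[OF summable_LIMSEQ[OF sm] filterlim_minus_const_nat_at_top])
  ultimately show "(\<lambda>M. adj_op g (?x M) m) \<longlonglongrightarrow> adj_op g x m" by simp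
  show "eventually (\<lambda>M. l2_bounded (adj_op g (?x M)) (K * C)) sequentially"
  proof (rule always_eventually, rule allI)
    fix M show "l2_bounded (adj_op g (?x M)) (K * C)"
      by (rule adj_op_finite_le[OF g _ l2_bounded_truncate[OF x], where M = M]) auto
  qed
qed auto

lemma adj_op_diff_right:
  assumes g: "g holomorphic_on ball 0 1" "\<And>z. cmod z < 1 \<Longrightarrow> cmod (g z) \<le> K" and x: "l2_bounded x C" "l2_bounded y D"
  shows "adj_op g (\<lambda>n. x n - y n) m = adj_op g x m - adj_op g y m"
  unfolding adj_op_def right_diff_distrib
  by (rule suminf_diff[symmetric]; rule summable_norm_cancel; rule adj_op_abs_summable[OF g]) (assumption | fact x)+

lemma adj_op_diff_left:
  assumes g: "g holomorphic_on ball 0 1" "\<And>z. cmod z < 1 \<Longrightarrow> cmod (g z) \<le> K"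
    and h: "h holomorphic_on ball 0 1" "\<And>z. cmod z < 1 \<Longrightarrow> cmod (h z) \<le> L" and x: "l2_bounded x C"
  shows "adj_op (\<lambda>z. g z - h z) x m = adj_op g x m - adj_op h x m"
  unfolding adj_op_def taylor_coeff_diff[OF g(1) h(1)] complex_cnj_diff left_diff_distrib
  by (rule suminf_diff[symmetric, OF summable_norm_cancel[OF adj_op_abs_summable[of g K x C]]
        summable_norm_cancel[OF adj_op_abs_summable[of h L x C]]]) (use assms in auto)

text \<open>For g (R z) with R < 1 the series is absolutely summable and the formula is the termwise
  one. As R tends to 1, the coefficient side converges by Tannery's theorem, with the absolutely
  convergent series for g itself as majorant, and the arc side by uniform continuity of g on the
  closed disc.\<close>

lemma adj_op_arc_coeff:
  assumes g: "g holomorphic_on ball 0 1" "continuous_on (cball 0 1) g"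
    and ab: "b \<le> a + 2 * pi" and \<phi>: "continuous_on {a..b} \<phi>"
  shows "adj_op g (arc_coeff a b \<phi>) m = arc_coeff a b (\<lambda>t. \<phi> t * cnj (g (cis t))) m"
proof -
  have "compact (g ` cball 0 1)" by (intro compact_continuous_image g) auto
  then obtain K where K: "\<And>z. z \<in> cball 0 1 \<Longrightarrow> cmod (g z) \<le> K"
    by (meson bounded_iff compact_imp_bounded imageI)
  have K': "\<And>z. cmod z < 1 \<Longrightarrow> cmod (g z) \<le> K" using K by auto
  define R where "R = (\<lambda>k. 1 - 1 / real (k + 2))"
  have R: "0 \<le> R k" "R k < 1" for k unfolding R_def by auto
  have Rlim: "R \<longlonglongrightarrow> 1"
    unfolding R_def
    using tendsto_diff[OF tendsto_const LIMSEQ_ignore_initial_segment[OF lim_1_over_n, of 2], of "1::real"] by simp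
  have inb: "cmod (of_real (R k) * cis t) < 1" for k t using R[of k] by (simp add: norm_mult)
  have gs: "(\<Sum>n. taylor_coeff g n * of_real (R k) ^ n * cis (real n * t)) = g (of_real (R k) * cis t)" for t k
    using sums_unique[OF taylor_sums[OF g(1) inb, of k t]]
    by (simp add: power_mult_distrib Complex.DeMoivre mult.assoc)
  have sm: "summable (\<lambda>n. cmod (taylor_coeff g n * of_real (R k) ^ n))" for k
    using taylor_abs_summable[OF g(1) R[of k]] R[of k] by (simp add: norm_mult norm_power)
  have 1: "(\<Sum>n. cnj (taylor_coeff g n * of_real (R k) ^ n) * arc_coeff a b \<phi> (m + n)) =
      arc_coeff a b (\<lambda>t. \<phi> t * cnj (g (of_real (R k) * cis t))) m" for k
    using sums_unique[OF arc_coeff_mult_cnj_series[OF \<phi> sm[of k], of m]] by (simp only: gs)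
  have abs: "summable (\<lambda>n. cmod (cnj (taylor_coeff g n) * arc_coeff a b \<phi> (m + n)))"
    by (rule adj_op_abs_summable[OF g(1) K' bessel[OF ab \<phi>]])
  have 2: "(\<lambda>k. \<Sum>n. cnj (taylor_coeff g n * of_real (R k) ^ n) * arc_coeff a b \<phi> (m + n)) \<longlonglongrightarrow> adj_op g (arc_coeff a b \<phi>) m"
    unfolding adj_op_def
  proof (rule tannerys_theorem[THEN conjunct2, THEN conjunct2, OF _ _ abs])
    fix n
    have "(\<lambda>k. cnj (taylor_coeff g n * of_real (R k) ^ n) * arc_coeff a b \<phi> (m + n)) \<longlonglongrightarrow>
       cnj (taylor_coeff g n * of_real 1 ^ n) * arc_coeff a b \<phi> (m + n)"
      by (intro tendsto_intros Rlim)
    then show "(\<lambda>k. cnj (taylor_coeff g n * of_real (R k) ^ n) * arc_coeff a b \<phi> (m + n)) \<longlonglongrightarrow>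
       cnj (taylor_coeff g n) * arc_coeff a b \<phi> (m + n)" by simp
  next
    show "\<forall>\<^sub>F (n, k) in sequentially \<times>\<^sub>F sequentially. cmod (cnj (taylor_coeff g n * of_real (R k) ^ n) * arc_coeff a b \<phi> (m + n))
        \<le> cmod (cnj (taylor_coeff g n) * arc_coeff a b \<phi> (m + n))"
    proof (intro always_eventually allI, safe)
      fix n k
      have "R k ^ n \<le> 1" using R[of k] by (intro power_le_one) auto
      then have "cmod (taylor_coeff g n) * R k ^ n * cmod (arc_coeff a b \<phi> (m + n)) \<le> cmod (taylor_coeff g n) * 1 * cmod (arc_coeff a b \<phi> (m + n))"
        by (intro mult_right_mono mult_left_mono) auto
      then show "cmod (cnj (taylor_coeff g n * of_real (R k) ^ n) * arc_coeff a b \<phi> (m + n))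
        \<le> cmod (cnj (taylor_coeff g n) * arc_coeff a b \<phi> (m + n))" using R[of k] by (simp add: norm_mult norm_power)
    qed
  qed simp
  have uc: "uniformly_continuous_on (cball 0 1) g" by (rule compact_uniformly_continuous) (use g in auto)
  have "uniform_limit {a..b} (\<lambda>k t. g (of_real (R k) * cis t)) (\<lambda>t. g (cis t)) sequentially"
    unfolding uniform_limit_iff
  proof (intro allI impI)
    fix e :: real assume "e > 0"
    then obtain d where d: "d > 0" "\<And>z w. z \<in> cball 0 1 \<Longrightarrow> w \<in> cball 0 1 \<Longrightarrow> dist w z < d \<Longrightarrow> dist (g w) (g z) < e"
      using uc unfolding uniformly_continuous_on_def by metis
    have "eventually (\<lambda>k. dist (R k) 1 < d) sequentially" using Rlim d(1) by (rule tendstoD)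
    then show "\<forall>\<^sub>F k in sequentially. \<forall>t\<in>{a..b}. dist (g (of_real (R k) * cis t)) (g (cis t)) < e"
    proof eventually_elim
      case (elim k)
      show ?case
      proof
        fix t
        have "dist (of_real (R k) * cis t) (cis t) = cmod ((of_real (R k) - 1) * cis t)" by (simp add: dist_norm algebra_simps)
        also have "\<dots> = cmod (of_real (R k - 1))" by (simp add: norm_mult)
        also have "\<dots> = dist (R k) 1" unfolding norm_of_real by (simp add: dist_real_def)
        finally show "dist (g (of_real (R k) * cis t)) (g (cis t)) < e"
          using elim inb[of k t] by (intro d(2)) (auto simp: less_imp_le)
      qed
    qed
  qed
  then have ul: "uniform_limit {a..b} (\<lambda>k t. cnj (g (of_real (R k) * cis t))) (\<lambda>t. cnj (g (cis t))) sequentially"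
    by (rule bounded_linear.uniform_limit[OF bounded_linear_cnj])
  have cgk: "continuous_on {a..b} (\<lambda>t. g (of_real (R k) * cis t))" for k
    by (intro continuous_intros continuous_on_compose2[OF g(2)] continuous_on_cis_id) (use inb in \<open>auto simp: less_imp_le\<close>)
  have cg: "continuous_on {a..b} (\<lambda>t. g (cis t))"
    by (intro continuous_on_compose2[OF g(2)] continuous_on_cis_id) auto
  have "uniform_limit {a..b} (\<lambda>k t. \<phi> t * cnj (g (of_real (R k) * cis t))) (\<lambda>t. \<phi> t * cnj (g (cis t))) sequentially"
    by (intro uniform_lim_mult ul uniform_limit_const)
      (auto intro!: compact_imp_bounded compact_continuous_image continuous_intros \<phi> cg)
  then have "(\<lambda>k. arc_coeff a b (\<lambda>t. \<phi> t * cnj (g (of_real (R k) * cis t))) m) \<longlonglongrightarrow> arc_coeff a b (\<lambda>t. \<phi> t * cnj (g (cis t))) m"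
    by (intro arc_coeff_tendsto) (auto intro!: continuous_intros \<phi> cgk)
  with 2 show ?thesis unfolding 1 by (rule LIMSEQ_unique)
qed

section \<open>Smooth bumps on the circle\<close>

definition rapid :: "(nat \<Rightarrow> complex) \<Rightarrow> bool" where
  "rapid c \<longleftrightarrow> (\<forall>k. summable (\<lambda>n. real n ^ k * cmod (c n)))"

definition pser :: "(nat \<Rightarrow> complex) \<Rightarrow> complex \<Rightarrow> complex" where
  "pser c z = (\<Sum>n. c n * z ^ n)"

lemma rapid_abs_summable: "rapid c \<Longrightarrow> summable (\<lambda>n. cmod (c n))"
  unfolding rapid_def by (drule spec[of _ 0]) simp

lemma norm_powser_term_le: "cmod z \<le> 1 \<Longrightarrow> cmod (c * z ^ n) \<le> cmod c"
  by (simp add: norm_mult norm_power mult_left_le power_le_one)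

lemma pser_sums:
  assumes "rapid c" "cmod z \<le> 1"
  shows "(\<lambda>n. c n * z ^ n) sums pser c z"
proof -
  have "summable (\<lambda>n. c n * z ^ n)"
    by (rule summable_comparison_test'[OF rapid_abs_summable[OF assms(1)], of 0])
      (simp add: norm_powser_term_le assms)
  then show ?thesis unfolding pser_def by (rule summable_sums)
qed

lemma continuous_on_pser:
  assumes "rapid c"
  shows "continuous_on (cball 0 1) (pser c)"
proof -
  have "uniform_limit (cball 0 1) (\<lambda>N z. \<Sum>n<N. c n * z ^ n) (\<lambda>z. \<Sum>n. c n * z ^ n) sequentially"
    by (rule Weierstrass_m_test) (auto intro: norm_powser_term_le rapid_abs_summable assms)
  then have "continuous_on (cball 0 1) (\<lambda>z. \<Sum>n. c n * z ^ n)"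
    by (rule uniform_limit_theorem[rotated]) (auto intro!: always_eventually continuous_intros)
  then show ?thesis by (simp add: pser_def[abs_def])
qed

lemma holomorphic_on_pser: "rapid c \<Longrightarrow> pser c holomorphic_on ball 0 1"
  by (rule taylor_unique(1)[OF pser_sums]) auto

lemma norm_pser_le:
  assumes "rapid c" "cmod z \<le> 1"
  shows "cmod (pser c z) \<le> (\<Sum>n. cmod (c n))"
  unfolding pser_def
  by (rule norm_suminf_le) (auto intro: norm_powser_term_le rapid_abs_summable assms)

lemma pser_0: "pser c 0 = c 0"
  by (simp add: pser_def)

lemma pser_radial:
  assumes "rapid c" "cmod z \<le> 1"
  shows "((\<lambda>r. pser c (of_real r * z)) \<longlongrightarrow> pser c z) (at_left 1)"
proof -
  have "((\<lambda>r::real. of_real r * z) \<longlongrightarrow> of_real 1 * z) (at_left 1)" by (intro tendsto_intros)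
  moreover have "eventually (\<lambda>r::real. r \<in> {0<..<1}) (at_left 1)" by (rule eventually_at_left_real) simp
  then have "eventually (\<lambda>r::real. of_real r * z \<in> cball 0 1) (at_left 1)"
    by eventually_elim (use assms(2) in \<open>auto simp: norm_mult intro: mult_le_one\<close>)
  ultimately show ?thesis
    using continuous_on_tendsto_compose[OF continuous_on_pser[OF assms(1)], of "\<lambda>r. of_real r * z" z "at_left (1::real)"] assms(2)
    by simp
qed

lemma rapidI:
  assumes "\<And>k. \<exists>C. \<forall>n. real n ^ k * cmod (c n) \<le> C"
  shows "rapid c"
  unfolding rapid_def
proof
  fix k
  \<comment> \<open>Two spare powers of n pay for comparison with the convergent series of 1 /
    n^2.\<close>
  obtain C where C: "\<And>n. real n ^ (k + 2) * cmod (c n) \<le> C" using assms[of "k + 2"] by blast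
  have "summable (\<lambda>n. C * inverse (real n ^ 2))"
    by (intro summable_mult inverse_power_summable) simp
  then show "summable (\<lambda>n. real n ^ k * cmod (c n))"
  proof (rule summable_comparison_test'[where N = 1])
    fix n :: nat assume n: "n \<ge> 1"
    have "real n ^ k * cmod (c n) = (real n ^ (k + 2) * cmod (c n)) * inverse (real n ^ 2)"
      using n by (simp add: power_add field_simps power2_eq_square)
    also have "\<dots> \<le> C * inverse (real n ^ 2)" by (rule mult_right_mono[OF C]) simp
    finally show "norm (real n ^ k * cmod (c n)) \<le> C * inverse (real n ^ 2)" by (simp add: norm_mult)
  qed
qed

lemma rapid_scale: "rapid c \<Longrightarrow> rapid (\<lambda>n. a * c n)"
  unfolding rapid_def norm_mult by (simp add: mult.left_commute summable_mult)

lemma rapid_add: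
  assumes "rapid c" "rapid d"
  shows "rapid (\<lambda>n. c n + d n)"
  unfolding rapid_def
proof
  fix k
  have "summable (\<lambda>n. real n ^ k * cmod (c n) + real n ^ k * cmod (d n))"
    using assms by (auto simp: rapid_def intro: summable_add)
  then show "summable (\<lambda>n. real n ^ k * cmod (c n + d n))"
    by (rule summable_comparison_test'[where N = 0])
      (auto simp: norm_mult distrib_left[symmetric] intro!: mult_left_mono norm_triangle_ineq)
qed

lemma rapid_zero: "rapid (\<lambda>n. 0)"
  by (simp add: rapid_def)

lemma pser_add:
  assumes "rapid c" "rapid d" "cmod z \<le> 1"
  shows "pser (\<lambda>n. c n + d n) z = pser c z + pser d z"
proof (rule sums_unique2)
  show "(\<lambda>n. (c n + d n) * z ^ n) sums pser (\<lambda>n. c n + d n) z" by (rule pser_sums) (auto intro: rapid_add assms)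
  show "(\<lambda>n. (c n + d n) * z ^ n) sums (pser c z + pser d z)"
    unfolding distrib_right by (intro sums_add pser_sums assms)
qed

lemma pser_scale:
  assumes "rapid c" "cmod z \<le> 1"
  shows "pser (\<lambda>n. a * c n) z = a * pser c z"
  unfolding pser_def mult.assoc by (rule suminf_mult) (use pser_sums[OF assms] in \<open>rule sums_summable\<close>)

lemma rapid_rotate: "rapid c \<Longrightarrow> rapid (\<lambda>n. c n * cis (real n * \<alpha>))"
  by (simp add: rapid_def norm_mult)

lemma pser_rotate: "pser (\<lambda>n. c n * cis (real n * \<alpha>)) z = pser c (cis \<alpha> * z)"
  by (simp add: pser_def power_mult_distrib Complex.DeMoivre mult.assoc)

section \<open>The sinc function and averages over rotations\<close>

definition sinc :: "real \<Rightarrow> real" where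
  "sinc x = (if x = 0 then 1 else sin x / x)"

lemma abs_sinc_le_one: "\<bar>sinc x\<bar> \<le> 1"
  by (simp add: sinc_def abs_sin_x_le_abs_x divide_le_eq)

text \<open>A linear bound is enough, since it is applied at arguments that shrink
  geometrically.\<close>

lemma abs_one_minus_sinc_le: "\<bar>1 - sinc x\<bar> \<le> \<bar>x\<bar>"
proof (cases "x = 0")
  case False
  have "\<bar>sin x - x\<bar> \<le> \<bar>x\<bar>\<^sup>2 / 2"
    using Maclaurin_sin_bound[of x 2] by (simp add: numeral_2_eq_2 sin_coeff_def)
  then have "\<bar>x - sin x\<bar> \<le> (\<bar>x\<bar> * \<bar>x\<bar>) / 2" by (simp only: abs_minus_commute power2_eq_square)
  then have "\<bar>x - sin x\<bar> \<le> \<bar>x\<bar> * \<bar>x\<bar>" using mult_nonneg_nonneg[of "\<bar>x\<bar>" "\<bar>x\<bar>"] by linarith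
  then have "\<bar>x - sin x\<bar> / \<bar>x\<bar> \<le> \<bar>x\<bar>" using False by (simp add: divide_le_eq)
  moreover have "1 - sinc x = (x - sin x) / x" using False by (simp add: sinc_def field_simps)
  ultimately show ?thesis by simp
qed (simp add: sinc_def)

lemma summable_bounded_powser:
  assumes "\<And>n. cmod (c n) \<le> B" "cmod z < 1"
  shows "summable (\<lambda>n. c n * z ^ n)"
proof (rule summable_comparison_test'[where N = 0])
  show "summable (\<lambda>n. B * cmod z ^ n)" using assms by (intro summable_mult summable_geometric) simp
qed (auto simp: norm_mult norm_power intro!: mult_right_mono assms)

text \<open>Multiplying the \<open>n\<close>-th coefficient by \<open>sinc (n * d)\<close> averages the function over rotations by
  angles in \<open>[-d, d]\<close>; the mean value theorem turns this average into a value.\<close>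

lemma averaging_step:
  assumes c: "\<And>n. cmod (c n) \<le> B" and d: "0 < d" and r: "0 \<le> r" "r < 1"
  shows "\<exists>s. \<bar>s - t\<bar> \<le> d \<and>
    Re (pser (\<lambda>n. c n * of_real (sinc (real n * d))) (of_real r * cis t)) = Re (pser c (of_real r * cis s))"
proof -
  \<comment> \<open>The zeroth entry is 0 because division by 0 yields 0: the constant term has no
    periodic primitive and enters \<open>V\<close> as the linear summand instead.\<close>
  define b where "b = (\<lambda>n. c n / of_nat n)"
  have B: "0 \<le> B" using c[of 0] norm_ge_zero order_trans by blast
  have b: "cmod (b n) \<le> B" for n
  proof (cases "n = 0")
    case False
    then have "cmod (c n) / real n \<le> cmod (c n) / 1" by (intro divide_left_mono) auto
    then show ?thesis using c[of n] by (simp add: b_def norm_divide)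
  qed (simp add: b_def B)
  define F where "F = (\<lambda>z. \<Sum>n. b n * z ^ n)"
  \<comment> \<open>A primitive in the angle of the real part: integrating z^n in the angle divides
    it by \<i> n, and the real part of a quotient by \<i> is an imaginary part.\<close>
  define V where "V = (\<lambda>s. s * Re (c 0) + Im (F (of_real r * cis s)))"
  have inb: "cmod (of_real r * cis s) < 1" for s using r by (simp add: norm_mult)
  have DF: "(F has_field_derivative (\<Sum>n. c (Suc n) * z ^ n)) (at z)" if "cmod z < 1" for z
  proof -
    have "(F has_field_derivative (\<Sum>n. diffs b n * z ^ n)) (at z)"
      unfolding F_def by (rule termdiffs_strong'[where K = 1]) (auto intro: summable_bounded_powser[OF b] that)
    moreover have "diffs b n = c (Suc n)" for n by (simp add: diffs_def b_def del: of_nat_Suc)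
    ultimately show ?thesis by simp
  qed
  have DV: "(V has_real_derivative Re (pser c (of_real r * cis s))) (at s)" for s
  proof -
    let ?z = "of_real r * cis s"
    have 1: "((\<lambda>s. of_real r * cis s) has_vector_derivative \<i> * ?z) (at s)"
      unfolding cis_conv_exp
      by (rule has_vector_derivative_real_field[where f = "\<lambda>z. of_real r * exp (\<i> * z)"])
        (auto intro!: derivative_eq_intros)
    have "((F \<circ> (\<lambda>s. of_real r * cis s)) has_vector_derivative (\<i> * ?z) * (\<Sum>n. c (Suc n) * ?z ^ n)) (at s)"
      by (rule field_vector_diff_chain_at[OF 1 DF[OF inb]])
    then have "((\<lambda>s. Im (F (of_real r * cis s))) has_vector_derivative Im ((\<i> * ?z) * (\<Sum>n. c (Suc n) * ?z ^ n))) (at s)"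
      using bounded_linear.has_vector_derivative[OF bounded_linear_Im] by (simp only: o_def)
    then have "((\<lambda>s. Im (F (of_real r * cis s))) has_real_derivative Im ((\<i> * ?z) * (\<Sum>n. c (Suc n) * ?z ^ n))) (at s)"
      by (simp only: has_real_derivative_iff_has_vector_derivative)
    moreover have "(\<i> * ?z) * (\<Sum>n. c (Suc n) * ?z ^ n) = \<i> * (pser c ?z - c 0)"
    proof -
      have sm: "summable (\<lambda>n. c n * ?z ^ n)" by (rule summable_bounded_powser[OF c inb])
      have sm': "summable (\<lambda>n. c (Suc n) * ?z ^ n)" by (rule summable_bounded_powser[OF c inb])
      have "pser c ?z - c 0 = (\<Sum>n. c (Suc n) * ?z ^ Suc n)"
        using suminf_split_head[OF sm] by (simp add: pser_def)
      also have "\<dots> = (\<Sum>n. ?z * (c (Suc n) * ?z ^ n))" by (simp only: power_Suc mult.left_commute)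
      also have "\<dots> = ?z * (\<Sum>n. c (Suc n) * ?z ^ n)" by (rule suminf_mult[OF sm'])
      finally show ?thesis by (simp only: mult.assoc)
    qed
    ultimately have "((\<lambda>s. Im (F (of_real r * cis s))) has_real_derivative Re (pser c ?z) - Re (c 0)) (at s)"
      by simp
    then have "(V has_real_derivative 1 * Re (c 0) + (Re (pser c ?z) - Re (c 0))) (at s)"
      unfolding V_def by (intro DERIV_add DERIV_cmult_right DERIV_ident)
    then show ?thesis by simp
  qed
  \<comment> \<open>The increment of \<open>V\<close> divided by 2 d is the average. The mean value
    theorem replaces it by one value, so no integral has to be carried through the
    iteration.\<close>
  obtain s where s: "t - d < s" "s < t + d" "V (t + d) - V (t - d) = (t + d - (t - d)) * Re (pser c (of_real r * cis s))"
    using MVT2[of "t - d" "t + d" V "\<lambda>s. Re (pser c (of_real r * cis s))"] DV d by auto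
  let ?c' = "\<lambda>n. c n * of_real (sinc (real n * d))"
  let ?z = "of_real r * cis t"
  have c': "cmod (?c' n) \<le> B" for n
  proof -
    have "cmod (?c' n) = cmod (c n) * \<bar>sinc (real n * d)\<bar>" by (simp add: norm_mult)
    also have "\<dots> \<le> B * 1" by (intro mult_mono c abs_sinc_le_one B) auto
    finally show ?thesis by simp
  qed
  have "F (of_real r * cis (t + d)) - F (of_real r * cis (t - d)) = (\<Sum>n. b n * (of_real r * cis (t + d)) ^ n - b n * (of_real r * cis (t - d)) ^ n)"
    unfolding F_def by (intro suminf_diff summable_bounded_powser[OF b inb])
  also have "\<dots> = (\<Sum>n. (2 * \<i> * of_real d) * (?c' n * ?z ^ n - (if n = 0 then c 0 else 0)))"
  proof (intro suminf_cong)
    fix n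
    show "b n * (of_real r * cis (t + d)) ^ n - b n * (of_real r * cis (t - d)) ^ n
      = (2 * \<i> * of_real d) * (?c' n * ?z ^ n - (if n = 0 then c 0 else 0))"
    proof (cases "n = 0")
      case False
      have "b n * (of_real r * cis (t + d)) ^ n - b n * (of_real r * cis (t - d)) ^ n
        = b n * of_real r ^ n * (cis (real n * t + real n * d) - cis (real n * t - real n * d))"
        by (simp add: power_mult_distrib Complex.DeMoivre algebra_simps)
      \<comment> \<open>The difference of the two rotations gives sin (n d); the division by n
        hidden in \<open>b\<close>, together with the factor d taken out in front, makes it
        sinc.\<close>
      also have "cis (real n * t + real n * d) - cis (real n * t - real n * d) = 2 * \<i> * of_real (sin (real n * d)) * cis (real n * t)"
        by (simp add: complex_eq_iff cos_add sin_add cos_diff sin_diff)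
      also have "b n * of_real r ^ n * (2 * \<i> * of_real (sin (real n * d)) * cis (real n * t))
        = (2 * \<i> * of_real d) * (?c' n * (of_real r ^ n * cis (real n * t)))"
        using False d by (simp add: b_def sinc_def field_simps)
      finally show ?thesis using False by (simp add: power_mult_distrib Complex.DeMoivre)
    qed (simp add: sinc_def b_def)
  qed
  also have "\<dots> = (2 * \<i> * of_real d) * (pser ?c' ?z - c 0)"
  proof -
    have "(\<lambda>n. ?c' n * ?z ^ n - (if n = 0 then c 0 else 0)) sums (pser ?c' ?z - c 0)"
      unfolding pser_def by (intro sums_diff summable_sums summable_bounded_powser[OF c' inb] sums_single)
    from sums_unique[OF sums_mult[OF this]] show ?thesis by simp
  qed
  finally have FF: "F (of_real r * cis (t + d)) - F (of_real r * cis (t - d)) = (2 * \<i> * of_real d) * (pser ?c' ?z - c 0)" .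
  have "V (t + d) - V (t - d) = 2 * d * Re (c 0) + Im (F (of_real r * cis (t + d)) - F (of_real r * cis (t - d)))"
    by (simp add: V_def algebra_simps)
  also have "\<dots> = 2 * d * Re (pser ?c' ?z)" unfolding FF by (simp add: algebra_simps)
  finally have "V (t + d) - V (t - d) = 2 * d * Re (pser ?c' ?z)" .
  moreover have "V (t + d) - V (t - d) = 2 * d * Re (pser c (of_real r * cis s))" using s(3) by simp
  ultimately have "2 * d * Re (pser ?c' ?z) = 2 * d * Re (pser c (of_real r * cis s))" by linarith
  then have "Re (pser ?c' ?z) = Re (pser c (of_real r * cis s))" using d by simp
  then show ?thesis using s by (intro exI[of _ s]) auto
qed

section \<open>The Poisson kernel and its iterated averages\<close>

definition poisson_coeff :: "nat \<Rightarrow> complex" where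
  "poisson_coeff n = (if n = 0 then 1 else 2)"

text \<open>The series is (1 + z) / (1 - z), obtained as twice the geometric series corrected at n =
  0; its real part is the Poisson kernel.\<close>

lemma Re_pser_poisson:
  assumes "0 \<le> r" "r < 1"
  shows "Re (pser poisson_coeff (of_real r * cis s)) = (1 - r\<^sup>2) / (1 - 2 * r * cos s + r\<^sup>2)"
proof -
  let ?z = "of_real r * cis s"
  have z: "cmod ?z < 1" using assms by (simp add: norm_mult)
  have "(\<lambda>n. 2 * ?z ^ n - (if n = 0 then 1 else 0)) sums (2 * (1 / (1 - ?z)) - 1)"
    by (intro sums_diff sums_mult geometric_sums z sums_single)
  also have "(\<lambda>n. 2 * ?z ^ n - (if n = 0 then 1 else 0)) = (\<lambda>n. poisson_coeff n * ?z ^ n)"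
    by (auto simp: poisson_coeff_def)
  finally have "pser poisson_coeff ?z = 2 * (1 / (1 - ?z)) - 1" unfolding pser_def by (rule sums_unique[symmetric])
  also have "Re \<dots> = 2 * ((1 - r * cos s) / ((1 - r * cos s)\<^sup>2 + (r * sin s)\<^sup>2)) - 1" by (simp add: Re_divide)
  also have "(1 - r * cos s)\<^sup>2 + (r * sin s)\<^sup>2 = 1 - 2 * r * cos s + r\<^sup>2"
  proof -
    have "(r * cos s)\<^sup>2 + (r * sin s)\<^sup>2 = r\<^sup>2"
      by (simp add: power_mult_distrib distrib_left[symmetric])
    then show ?thesis by (simp add: power2_diff)
  qed
  also have "2 * ((1 - r * cos s) / (1 - 2 * r * cos s + r\<^sup>2)) - 1 = (1 - r\<^sup>2) / (1 - 2 * r * cos s + r\<^sup>2)"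
  proof -
    have "(1 - r)\<^sup>2 \<le> 1 - 2 * r * cos s + r\<^sup>2"
      using mult_left_mono[OF cos_le_one[of s], of "2 * r"] assms by (simp add: power2_eq_square algebra_simps)
    moreover have "0 < (1 - r)\<^sup>2" using assms by simp
    ultimately have "1 - 2 * r * cos s + r\<^sup>2 \<noteq> 0" by linarith
    then show ?thesis by (simp add: field_simps)
  qed
  finally show ?thesis .
qed

lemma Re_pser_poisson_nonneg:
  assumes "0 \<le> r" "r < 1"
  shows "0 \<le> Re (pser poisson_coeff (of_real r * cis s))"
  unfolding Re_pser_poisson[OF assms]
proof (rule divide_nonneg_nonneg)
  show "0 \<le> 1 - r\<^sup>2" using assms by (simp add: power_le_one)
  have "0 \<le> (1 - r)\<^sup>2" by simp
  also have "\<dots> \<le> 1 - 2 * r * cos s + r\<^sup>2"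
    using mult_left_mono[OF cos_le_one[of s], of "2 * r"] assms by (simp add: power2_eq_square algebra_simps)
  finally show "0 \<le> 1 - 2 * r * cos s + r\<^sup>2" .
qed

text \<open>Away from the angle 0 the denominator is at least its value at \<delta>, which is (sin
  \<delta>)^2 plus a square. As r tends to 1 the kernel therefore dies uniformly off an arc around
  1.\<close>

lemma Re_pser_poisson_le:
  assumes "0 \<le> r" "r < 1" "0 < \<delta>" "\<delta> < pi" "\<delta> \<le> s" "s \<le> 2 * pi - \<delta>"
  shows "Re (pser poisson_coeff (of_real r * cis s)) \<le> (1 - r\<^sup>2) / (sin \<delta>)\<^sup>2"
  unfolding Re_pser_poisson[OF assms(1,2)]
proof (rule divide_left_mono)
  have "cos s \<le> cos \<delta>"
  proof (cases "s \<le> pi")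
    case True
    then show ?thesis using assms by (intro cos_monotone_0_pi_le) auto
  next
    case False
    have "cos s = cos (2 * pi - s)" by simp
    also have "\<dots> \<le> cos \<delta>" using False assms by (intro cos_monotone_0_pi_le) auto
    finally show ?thesis .
  qed
  then have "2 * r * cos s \<le> 2 * r * cos \<delta>" using assms by (intro mult_left_mono) auto
  moreover have "(sin \<delta>)\<^sup>2 + (r - cos \<delta>)\<^sup>2 = 1 - 2 * r * cos \<delta> + r\<^sup>2"
    using sin_cos_squared_add[of \<delta>] by (simp add: power2_eq_square algebra_simps)
  ultimately show 1: "(sin \<delta>)\<^sup>2 \<le> 1 - 2 * r * cos s + r\<^sup>2" using zero_le_power2[of "r - cos \<delta>"] by linarith
  show "0 \<le> 1 - r\<^sup>2" using assms by (simp add: power_le_one)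
  have "0 < (sin \<delta>)\<^sup>2" using sin_gt_zero[of \<delta>] assms by simp
  then show "0 < (1 - 2 * r * cos s + r\<^sup>2) * (sin \<delta>)\<^sup>2" using 1 by (intro mult_pos_pos) linarith+
qed

text \<open>J successive averages of the Poisson kernel with half-widths \<delta>/2, \<delta>/4,
  ...: the total displacement stays below \<delta>, while each factor contributes one power of 1 / n
  of decay.\<close>

definition bump_coeff :: "real \<Rightarrow> nat \<Rightarrow> nat \<Rightarrow> complex" where
  "bump_coeff \<delta> J n = poisson_coeff n * of_real (\<Prod>j<J. sinc (real n * (\<delta> / 2 ^ Suc j)))"

lemma abs_prod_sinc_le_one: "\<bar>\<Prod>j<J. sinc (f j)\<bar> \<le> 1"
  unfolding abs_prod by (rule prod_le_1) (simp add: abs_sinc_le_one)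

lemma norm_bump_coeff_le: "cmod (bump_coeff \<delta> J n) \<le> 2"
proof -
  have "cmod (bump_coeff \<delta> J n) = cmod (poisson_coeff n) * \<bar>\<Prod>j<J. sinc (real n * (\<delta> / 2 ^ Suc j))\<bar>"
    unfolding bump_coeff_def norm_mult norm_of_real ..
  also have "\<dots> \<le> 2 * 1" by (intro mult_mono abs_prod_sinc_le_one) (auto simp: poisson_coeff_def)
  finally show ?thesis by simp
qed

text \<open>J uses of \<open>averaging_step\<close> move the point of evaluation by at most
  \<delta>/2 + ... + \<delta>/2^J. Pointwise bounds for the Poisson kernel thus pass to its
  averages, at the cost of a shift in the angle only.\<close>

lemma bump_coeff_average:
  assumes "0 < \<delta>" "0 \<le> r" "r < 1"
  shows "\<exists>s. \<bar>s - t\<bar> \<le> \<delta> - \<delta> / 2 ^ J \<and>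
    Re (pser (bump_coeff \<delta> J) (of_real r * cis t)) = Re (pser poisson_coeff (of_real r * cis s))"
proof (induction J arbitrary: t)
  case 0
  have "bump_coeff \<delta> 0 = poisson_coeff" by (rule ext) (simp add: bump_coeff_def)
  then show ?case by (intro exI[of _ t]) simp
next
  case (Suc J)
  have eq: "bump_coeff \<delta> (Suc J) = (\<lambda>n. bump_coeff \<delta> J n * of_real (sinc (real n * (\<delta> / 2 ^ Suc J))))"
    by (rule ext) (simp add: bump_coeff_def mult.assoc)
  obtain s where s: "\<bar>s - t\<bar> \<le> \<delta> / 2 ^ Suc J"
    "Re (pser (bump_coeff \<delta> (Suc J)) (of_real r * cis t)) = Re (pser (bump_coeff \<delta> J) (of_real r * cis s))"
    using averaging_step[where c = "bump_coeff \<delta> J" and d = "\<delta> / 2 ^ Suc J" and r = r and t = t, OF norm_bump_coeff_le] assms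
    unfolding eq by auto
  obtain u where u: "\<bar>u - s\<bar> \<le> \<delta> - \<delta> / 2 ^ J" "Re (pser (bump_coeff \<delta> J) (of_real r * cis s)) = Re (pser poisson_coeff (of_real r * cis u))"
    using Suc.IH[of s] by blast
  have "\<delta> / 2 ^ J = 2 * (\<delta> / 2 ^ Suc J)" by simp
  then have "\<bar>u - t\<bar> \<le> \<delta> - \<delta> / 2 ^ Suc J" using s(1) u(1) by linarith
  then show ?case using s(2) u(2) by (intro exI[of _ u]) auto
qed

text \<open>Consecutive partial products differ by at most a constant times 2^(-J), because the new
  factor is that close to 1 and the old product has modulus at most 1.\<close>

lemma convergent_bump_coeff:
  assumes "0 < \<delta>"
  shows "convergent (\<lambda>J. bump_coeff \<delta> J n)"
proof -
  let ?P = "\<lambda>J. \<Prod>j<J. sinc (real n * (\<delta> / 2 ^ Suc j))"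
  have "summable (\<lambda>J. ?P (Suc J) - ?P J)"
  proof (rule summable_comparison_test'[where N = 0])
    show "summable (\<lambda>J. (real n * \<delta>) * (1 / 2) ^ J)" by (intro summable_mult summable_geometric) simp
    fix J
    have "?P (Suc J) - ?P J = ?P J * (sinc (real n * (\<delta> / 2 ^ Suc J)) - 1)" by (simp add: algebra_simps)
    then have "norm (?P (Suc J) - ?P J) = \<bar>?P J\<bar> * \<bar>1 - sinc (real n * (\<delta> / 2 ^ Suc J))\<bar>"
      by (simp only: real_norm_def abs_mult abs_minus_commute)
    also have "\<dots> \<le> 1 * \<bar>real n * (\<delta> / 2 ^ Suc J)\<bar>"
      by (intro mult_mono abs_prod_sinc_le_one abs_one_minus_sinc_le) auto
    also have "\<dots> \<le> (real n * \<delta>) * (1 / 2) ^ J" using assms by (simp add: abs_mult field_simps)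
    finally show "norm (?P (Suc J) - ?P J) \<le> (real n * \<delta>) * (1 / 2) ^ J" .
  qed
  then have "convergent (\<lambda>J. \<Sum>j<J. ?P (Suc j) - ?P j)" by (simp only: summable_iff_convergent)
  then have "convergent (\<lambda>J. ?P J - ?P 0)" unfolding sum_lessThan_telescope[of ?P] .
  then have "convergent (\<lambda>J. (?P J - ?P 0) + ?P 0)" by (rule convergent_add) (rule convergent_const)
  then have "convergent ?P" by simp
  then obtain L where "?P \<longlonglongrightarrow> L" by (auto simp: convergent_def)
  then have "(\<lambda>J. bump_coeff \<delta> J n) \<longlonglongrightarrow> poisson_coeff n * of_real L"
    unfolding bump_coeff_def by (intro tendsto_intros)
  then show ?thesis by (auto simp: convergent_def)
qed

text \<open>The first k factors absorb n^k, each costing the reciprocal of its half-width; the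
  others have modulus at most 1. The bound is independent of J and so passes to the limit.\<close>

lemma bump_coeff_decay:
  assumes "0 < \<delta>" "k \<le> J"
  shows "real n ^ k * cmod (bump_coeff \<delta> J n) \<le> 2 * (\<Prod>j<k. 2 ^ Suc j / \<delta>)"
proof -
  let ?s = "\<lambda>j. sinc (real n * (\<delta> / 2 ^ Suc j))"
  have 1: "\<bar>\<Prod>j<J. ?s j\<bar> \<le> \<bar>\<Prod>j<k. ?s j\<bar>"
  proof -
    have "(\<Prod>j<J. ?s j) = (\<Prod>j<k. ?s j) * (\<Prod>j\<in>{k..<J}. ?s j)"
      using prod.atLeastLessThan_concat[of 0 k J ?s] assms(2) by (simp only: lessThan_atLeast0 le0)
    moreover have "\<bar>\<Prod>j\<in>{k..<J}. ?s j\<bar> \<le> 1" unfolding abs_prod by (rule prod_le_1) (simp add: abs_sinc_le_one)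
    ultimately show ?thesis by (simp only: abs_mult mult_left_le abs_ge_zero)
  qed
  have 2: "real n * \<bar>?s j\<bar> \<le> 2 ^ Suc j / \<delta>" for j
  proof (cases "n = 0")
    case False
    have "real n * \<bar>?s j\<bar> = \<bar>sin (real n * (\<delta> / 2 ^ Suc j))\<bar> * (2 ^ Suc j / \<delta>)"
      using False assms(1) by (simp add: sinc_def abs_mult)
    also have "\<dots> \<le> 1 * (2 ^ Suc j / \<delta>)" by (intro mult_right_mono) (use assms in auto)
    finally show ?thesis by simp
  qed (use assms in simp)
  have "real n ^ k * cmod (bump_coeff \<delta> J n) = real n ^ k * (cmod (poisson_coeff n) * \<bar>\<Prod>j<J. ?s j\<bar>)"
    unfolding bump_coeff_def norm_mult norm_of_real ..
  also have "\<dots> \<le> real n ^ k * (2 * \<bar>\<Prod>j<k. ?s j\<bar>)"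
    by (intro mult_left_mono mult_mono 1) (auto simp: poisson_coeff_def)
  also have "\<dots> = 2 * (\<Prod>j<k. real n * \<bar>?s j\<bar>)" by (simp add: prod.distrib abs_prod)
  also have "\<dots> \<le> 2 * (\<Prod>j<k. 2 ^ Suc j / \<delta>)" by (intro mult_left_mono prod_mono conjI 2) auto
  finally show ?thesis .
qed

text \<open>Two limits in this order: J to infinity at a fixed radius r < 1, with estimates uniform
  in J, then r to 1, where the rapid decay gives continuity. The value at angle t is a kernel value
  at an angle within \<delta> of t, so beyond 2 \<delta> the kernel bound applies; it tends to 0 and
  combines with nonnegativity to an exact zero.\<close>

lemma bump_exists:
  assumes "0 < \<delta>" "\<delta> < pi"
  shows "\<exists>c. rapid c \<and> c 0 = 1 \<and> (\<forall>z. cmod z \<le> 1 \<longrightarrow> 0 \<le> Re (pser c z)) \<and>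
    (\<forall>t. 2 * \<delta> \<le> t \<and> t \<le> 2 * pi - 2 * \<delta> \<longrightarrow> Re (pser c (cis t)) = 0)"
proof -
  obtain c where c: "\<And>n. (\<lambda>J. bump_coeff \<delta> J n) \<longlonglongrightarrow> c n"
    using convergent_bump_coeff[OF assms(1)] unfolding convergent_def by metis
  have rc: "rapid c"
  proof (rule rapidI, intro exI allI)
    fix k n
    show "real n ^ k * cmod (c n) \<le> 2 * (\<Prod>j<k. 2 ^ Suc j / \<delta>)"
    proof (rule tendsto_upperbound)
      show "(\<lambda>J. real n ^ k * cmod (bump_coeff \<delta> J n)) \<longlonglongrightarrow> real n ^ k * cmod (c n)" by (intro tendsto_intros c)
      show "eventually (\<lambda>J. real n ^ k * cmod (bump_coeff \<delta> J n) \<le> 2 * (\<Prod>j<k. 2 ^ Suc j / \<delta>)) sequentially"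
        using eventually_ge_at_top[of k] by eventually_elim (rule bump_coeff_decay[OF assms(1)])
    qed simp
  qed
  have "(\<lambda>J. bump_coeff \<delta> J 0) = (\<lambda>J. 1)" by (simp add: bump_coeff_def poisson_coeff_def sinc_def)
  then have c0: "c 0 = 1" using c[of 0] by (simp add: LIMSEQ_const_iff)
  have lim: "(\<lambda>J. Re (pser (bump_coeff \<delta> J) z)) \<longlonglongrightarrow> Re (pser c z)" if z: "cmod z < 1" for z
  proof (rule tendsto_Re)
    have sm: "summable (\<lambda>n. 2 * cmod z ^ n)" using z by (intro summable_mult summable_geometric) simp
    show "(\<lambda>J. pser (bump_coeff \<delta> J) z) \<longlonglongrightarrow> pser c z"
      unfolding pser_def
    proof (rule tannerys_theorem[THEN conjunct2, THEN conjunct2, OF _ _ sm])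
      show "(\<lambda>J. bump_coeff \<delta> J n * z ^ n) \<longlonglongrightarrow> c n * z ^ n" for n by (intro tendsto_intros c)
      show "\<forall>\<^sub>F (n, J) in sequentially \<times>\<^sub>F sequentially. cmod (bump_coeff \<delta> J n * z ^ n) \<le> 2 * cmod z ^ n"
        by (intro always_eventually allI) (auto simp: norm_mult norm_power intro!: mult_right_mono norm_bump_coeff_le)
    qed simp
  qed
  have nn: "0 \<le> Re (pser c (of_real r * cis t))" if r: "0 \<le> r" "r < 1" for r t
  proof (rule tendsto_lowerbound[OF lim])
    show "cmod (of_real r * cis t) < 1" using r by (simp add: norm_mult)
    show "eventually (\<lambda>J. 0 \<le> Re (pser (bump_coeff \<delta> J) (of_real r * cis t))) sequentially"
    proof (intro always_eventually allI)
      fix J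
      show "0 \<le> Re (pser (bump_coeff \<delta> J) (of_real r * cis t))"
        using bump_coeff_average[OF assms(1) r, of t J] Re_pser_poisson_nonneg[OF r] by auto
    qed
  qed simp
  have le: "Re (pser c (of_real r * cis t)) \<le> (1 - r\<^sup>2) / (sin \<delta>)\<^sup>2"
    if r: "0 \<le> r" "r < 1" and t: "2 * \<delta> \<le> t" "t \<le> 2 * pi - 2 * \<delta>" for r t
  proof (rule tendsto_upperbound[OF lim])
    show "cmod (of_real r * cis t) < 1" using r by (simp add: norm_mult)
    show "eventually (\<lambda>J. Re (pser (bump_coeff \<delta> J) (of_real r * cis t)) \<le> (1 - r\<^sup>2) / (sin \<delta>)\<^sup>2) sequentially"
    proof (intro always_eventually allI)
      fix J
      obtain s where s: "\<bar>s - t\<bar> \<le> \<delta> - \<delta> / 2 ^ J"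
        "Re (pser (bump_coeff \<delta> J) (of_real r * cis t)) = Re (pser poisson_coeff (of_real r * cis s))"
        using bump_coeff_average[OF assms(1) r, of t J] by blast
      have "0 \<le> \<delta> / 2 ^ J" using assms by simp
      then have "\<delta> \<le> s" "s \<le> 2 * pi - \<delta>" using s(1) t by linarith+
      then show "Re (pser (bump_coeff \<delta> J) (of_real r * cis t)) \<le> (1 - r\<^sup>2) / (sin \<delta>)\<^sup>2"
        unfolding s(2) by (intro Re_pser_poisson_le r assms)
    qed
  qed simp
  have ev01: "eventually (\<lambda>r::real. r \<in> {0<..<1}) (at_left 1)" by (rule eventually_at_left_real) simp
  have nnb: "0 \<le> Re (pser c (cis t))" for t
  proof (rule tendsto_lowerbound)
    show "((\<lambda>r. Re (pser c (of_real r * cis t))) \<longlongrightarrow> Re (pser c (cis t))) (at_left 1)"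
      by (intro tendsto_Re pser_radial rc) simp
    show "eventually (\<lambda>r::real. 0 \<le> Re (pser c (of_real r * cis t))) (at_left 1)"
      using ev01 by eventually_elim (auto intro: nn)
  qed simp
  have leb: "Re (pser c (cis t)) \<le> 0" if t: "2 * \<delta> \<le> t" "t \<le> 2 * pi - 2 * \<delta>" for t
  proof (rule tendsto_le)
    show "((\<lambda>r. Re (pser c (of_real r * cis t))) \<longlongrightarrow> Re (pser c (cis t))) (at_left 1)"
      by (intro tendsto_Re pser_radial rc) simp
    have "((\<lambda>r::real. (1 - r\<^sup>2) * inverse ((sin \<delta>)\<^sup>2)) \<longlongrightarrow> (1 - 1\<^sup>2) * inverse ((sin \<delta>)\<^sup>2)) (at_left 1)"
      by (intro tendsto_intros)
    then show "((\<lambda>r::real. (1 - r\<^sup>2) / (sin \<delta>)\<^sup>2) \<longlongrightarrow> 0) (at_left 1)" by (simp add: divide_inverse)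
    show "eventually (\<lambda>r::real. Re (pser c (of_real r * cis t)) \<le> (1 - r\<^sup>2) / (sin \<delta>)\<^sup>2) (at_left 1)"
      using ev01 by eventually_elim (auto intro: le t)
  qed simp
  have "0 \<le> Re (pser c z)" if "cmod z \<le> 1" for z
  proof -
    have z: "z = of_real (cmod z) * cis (Arg z)" using rcis_cmod_Arg[of z] by (simp add: rcis_def)
    show ?thesis
    proof (cases "cmod z = 1")
      case True
      then show ?thesis using nnb[of "Arg z"] z by simp
    next
      case False
      then show ?thesis using nn[of "cmod z" "Arg z"] that z by simp
    qed
  qed
  then show ?thesis using rc c0 nnb leb by (intro exI[of _ c]) (auto intro: antisym)
qed

text \<open>Mean value 1 forces a positive real part somewhere on the circle: otherwise exp of the
  series would have modulus at most 1 there, against its value exp 1 at 0. That point lies near 1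
  and is rotated to \<open>cis t0\<close>.\<close>

lemma bump_at:
  assumes "0 < \<rho>" "\<rho> < pi"
  shows "\<exists>c. rapid c \<and> (\<forall>z. cmod z \<le> 1 \<longrightarrow> 0 \<le> Re (pser c z)) \<and> 0 < Re (pser c (cis t0)) \<and>
    (\<forall>t. \<rho> \<le> t - t0 \<and> t - t0 \<le> 2 * pi - \<rho> \<longrightarrow> Re (pser c (cis t)) = 0)"
proof -
  \<comment> \<open>The positive point has an angle within 2 \<delta> of 0 and the real part
    vanishes beyond 2 \<delta>, so after the rotation it vanishes beyond 4 \<delta> = \<rho> from
    \<open>t0\<close>.\<close>
  define \<delta> where "\<delta> = \<rho> / 4"
  obtain c where c: "rapid c" "c 0 = 1" "\<And>z. cmod z \<le> 1 \<Longrightarrow> 0 \<le> Re (pser c z)"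
    "\<And>t. 2 * \<delta> \<le> t \<Longrightarrow> t \<le> 2 * pi - 2 * \<delta> \<Longrightarrow> Re (pser c (cis t)) = 0"
    using bump_exists[of \<delta>] assms by (auto simp: \<delta>_def)
  have "\<exists>z. cmod z = 1 \<and> 0 < Re (pser c z)"
  proof (rule ccontr)
    assume "\<not> (\<exists>z. cmod z = 1 \<and> 0 < Re (pser c z))"
    then have 1: "\<And>z. cmod z = 1 \<Longrightarrow> cmod (exp (pser c z)) \<le> 1" by (auto simp: not_less)
    have 2: "(\<lambda>z. exp (pser c z)) holomorphic_on ball 0 1" by (intro holomorphic_intros holomorphic_on_pser c)
    have 3: "continuous_on (cball 0 1) (\<lambda>z. exp (pser c z))" by (intro continuous_intros continuous_on_pser c)
    have "cmod (exp (pser c 0)) \<le> 1"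
    proof (rule maximum_modulus_frontier[where S = "ball 0 1" and f = "\<lambda>z. exp (pser c z)"])
      show "(\<lambda>z. exp (pser c z)) holomorphic_on interior (ball 0 1)" using 2 by (simp only: interior_open[OF open_ball])
      show "continuous_on (closure (ball 0 1)) (\<lambda>z. exp (pser c z))" using 3 by (simp only: closure_ball zero_less_one)
      show "cmod (exp (pser c z)) \<le> 1" if "z \<in> frontier (ball 0 1)" for z
        using that by (intro 1) (simp add: frontier_ball)
    qed auto
    then show False by (simp add: pser_0 c)
  qed
  then obtain z where z: "cmod z = 1" "0 < Re (pser c z)" by blast
  have zz: "z = cis (Arg z)" using rcis_cmod_Arg[of z] z by (simp add: rcis_def)
  \<comment> \<open>The angle is normalised to the period starting at -2 \<delta>, in which the
    known zero set of the bump is a single interval reaching the right end.\<close>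
  define s where "s = (if Arg z < - 2 * \<delta> then Arg z + 2 * pi else Arg z)"
  have zs: "z = cis s" using zz by (simp add: s_def cis_mult[symmetric])
  have b: "- 2 * \<delta> \<le> s \<and> s \<le> 2 * pi - 2 * \<delta>"
    using Arg_bounded[of z] assms unfolding s_def \<delta>_def by auto
  then have s: "- 2 * \<delta> \<le> s" "s < 2 * \<delta>" using c(4)[of s] z(2) zs by (auto simp: not_le[symmetric])
  let ?c = "\<lambda>n. c n * cis (real n * (s - t0))"
  have e: "pser ?c (cis t) = pser c (cis (t - t0 + s))" for t unfolding pser_rotate by (simp add: cis_mult algebra_simps)
  have "0 \<le> Re (pser ?c z)" if "cmod z \<le> 1" for z unfolding pser_rotate by (rule c) (simp add: norm_mult that)
  moreover have "0 < Re (pser ?c (cis t0))" unfolding e using z zs by simp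
  moreover have "Re (pser ?c (cis t)) = 0" if "\<rho> \<le> t - t0" "t - t0 \<le> 2 * pi - \<rho>" for t
    unfolding e by (rule c) (use that s in \<open>auto simp: \<delta>_def\<close>)
  ultimately show ?thesis using rapid_rotate[OF c(1)] by (intro exI[of _ ?c]) auto
qed

text \<open>The flat arc may depend on \<open>c\<close>. The class is a convex cone, hence stable
  under each stage of the construction, but limits can lose the arc, as the final \<open>w\<close>
  must.\<close>

definition flat_at_one :: "(nat \<Rightarrow> complex) \<Rightarrow> bool" where
  "flat_at_one c \<longleftrightarrow> rapid c \<and> (\<forall>z. cmod z \<le> 1 \<longrightarrow> 0 \<le> Re (pser c z)) \<and>
     (\<exists>\<theta>>0. \<forall>t. \<bar>t\<bar> \<le> \<theta> \<longrightarrow> Re (pser c (cis t)) = 0)"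

lemma flat_at_one_scale:
  assumes "flat_at_one c" "0 \<le> a"
  shows "flat_at_one (\<lambda>n. of_real a * c n)"
proof -
  have "Re (pser (\<lambda>n. of_real a * c n) z) = a * Re (pser c z)" if "cmod z \<le> 1" for z
    using assms that by (simp add: pser_scale flat_at_one_def)
  then show ?thesis using assms by (auto simp: flat_at_one_def rapid_scale)
qed

lemma flat_at_one_add:
  assumes "flat_at_one c" "flat_at_one d"
  shows "flat_at_one (\<lambda>n. c n + d n)"
proof -
  have e: "Re (pser (\<lambda>n. c n + d n) z) = Re (pser c z) + Re (pser d z)" if "cmod z \<le> 1" for z
    using assms that by (simp add: pser_add flat_at_one_def)
  obtain \<theta>1 \<theta>2 where th: "\<theta>1 > 0" "\<And>t. \<bar>t\<bar> \<le> \<theta>1 \<Longrightarrow> Re (pser c (cis t)) = 0"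
    "\<theta>2 > 0" "\<And>t. \<bar>t\<bar> \<le> \<theta>2 \<Longrightarrow> Re (pser d (cis t)) = 0"
    using assms unfolding flat_at_one_def by blast
  then have "\<exists>\<theta>>0. \<forall>t. \<bar>t\<bar> \<le> \<theta> \<longrightarrow> Re (pser (\<lambda>n. c n + d n) (cis t)) = 0"
    by (intro exI[of _ "min \<theta>1 \<theta>2"]) (auto simp: e)
  then show ?thesis using assms by (auto simp: flat_at_one_def rapid_add e)
qed

lemma flat_at_one_zero: "flat_at_one (\<lambda>n. 0)"
  by (auto simp: flat_at_one_def rapid_zero pser_def intro: exI[of _ 1])

lemma flat_at_one_at:
  assumes "0 < t0" "t0 < 2 * pi"
  shows "\<exists>c. flat_at_one c \<and> 0 < Re (pser c (cis t0))"
proof -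
  \<comment> \<open>Half the angular distance from \<open>t0\<close> to 0 leaves equal room for the
    bump around \<open>t0\<close> and for the flat arc around 0.\<close>
  define \<rho> where "\<rho> = min t0 (2 * pi - t0) / 2"
  have \<rho>: "0 < \<rho>" "\<rho> < pi" "2 * \<rho> \<le> t0" "2 * \<rho> \<le> 2 * pi - t0" using assms by (auto simp: \<rho>_def min_def)
  obtain c where c: "rapid c" "\<And>z. cmod z \<le> 1 \<Longrightarrow> 0 \<le> Re (pser c z)" "0 < Re (pser c (cis t0))"
    "\<And>t. \<rho> \<le> t - t0 \<Longrightarrow> t - t0 \<le> 2 * pi - \<rho> \<Longrightarrow> Re (pser c (cis t)) = 0"
    using bump_at[OF \<rho>(1,2), of t0] by auto
  have "Re (pser c (cis t)) = 0" if "\<bar>t\<bar> \<le> \<rho>" for t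
  proof -
    have "cis t = cis (t + 2 * pi)" by (simp add: cis_mult[symmetric])
    moreover have "Re (pser c (cis (t + 2 * pi))) = 0" by (rule c(4)) (use that \<rho> in auto)
    ultimately show ?thesis by simp
  qed
  then show ?thesis using c \<rho>(1) unfolding flat_at_one_def by blast
qed

text \<open>The positivity sets are open and cover the interval, so by Lindelof countably many bumps
  suffice. Dividing the k-th bump by a bound for its norms of orders 0 to k lets a single summable
  sequence of weights serve all norms at once.\<close>

lemma flat_at_one_family:
  "\<exists>c. (\<forall>k. flat_at_one (c k) \<and> (\<forall>j\<le>k. (\<Sum>n. real n ^ j * cmod (c k n)) \<le> 1)) \<and>
     (\<forall>t. 0 < t \<and> t < 2 * pi \<longrightarrow> (\<exists>k. 0 < Re (pser (c k) (cis t))))"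
proof -
  define U where "U = (\<lambda>c. {t::real. 0 < Re (pser c (cis t))})"
  have "open S" if S: "S \<in> U ` Collect flat_at_one" for S
  proof -
    obtain c where c: "flat_at_one c" "S = U c" using S by blast
    have "continuous_on UNIV (\<lambda>t. Re (pser c (cis t)))"
      using c by (intro continuous_intros continuous_on_compose2[OF continuous_on_pser continuous_on_cis_id]) (auto simp: flat_at_one_def)
    then show ?thesis unfolding c(2) U_def by (intro open_Collect_less continuous_on_const)
  qed
  then obtain F where F: "F \<subseteq> U ` Collect flat_at_one" "countable F" "\<Union>F = \<Union>(U ` Collect flat_at_one)"
    by (rule Lindelof) blast
  then obtain G where G: "countable G" "G \<subseteq> Collect flat_at_one" "F = U ` G"
    using countable_subset_image[of F U "Collect flat_at_one"] by blast
  \<comment> \<open>The zero sequence makes the set nonempty, as its enumeration by all natural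
    numbers requires.\<close>
  define G' where "G' = insert (\<lambda>n. 0) G"
  have G': "countable G'" "G' \<noteq> {}" "\<And>c. c \<in> G' \<Longrightarrow> flat_at_one c"
    using G flat_at_one_zero by (auto simp: G'_def)
  define e where "e = from_nat_into G'"
  have e: "flat_at_one (e k)" for k unfolding e_def by (intro G' from_nat_into)
  define N where "N = (\<lambda>k. 1 + (\<Sum>j\<le>k. \<Sum>n. real n ^ j * cmod (e k n)))"
  have sm: "summable (\<lambda>n. real n ^ j * cmod (e k n))" for j k using e[of k] by (simp add: flat_at_one_def rapid_def)
  have N: "N k \<ge> 1" for k unfolding N_def using suminf_nonneg[OF sm] by (simp add: sum_nonneg)
  define c where "c = (\<lambda>k n. of_real (1 / N k) * e k n)"
  have g: "flat_at_one (c k)" for k unfolding c_def using N[of k] by (intro flat_at_one_scale e) simp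
  have b: "(\<Sum>n. real n ^ j * cmod (c k n)) \<le> 1" if j: "j \<le> k" for j k
  proof -
    have "(\<Sum>n. real n ^ j * cmod (c k n)) = (\<Sum>n. (1 / N k) * (real n ^ j * cmod (e k n)))"
      unfolding c_def norm_mult norm_of_real using N[of k] by (simp add: mult_ac)
    also have "\<dots> = (1 / N k) * (\<Sum>n. real n ^ j * cmod (e k n))" by (rule suminf_mult[OF sm])
    also have "(\<Sum>n. real n ^ j * cmod (e k n)) \<le> (\<Sum>j\<le>k. \<Sum>n. real n ^ j * cmod (e k n))"
      by (rule member_le_sum) (use j in \<open>auto intro!: suminf_nonneg sm\<close>)
    also have "\<dots> \<le> N k" by (simp add: N_def)
    finally show ?thesis using N[of k] by (simp add: divide_le_eq)
  qed
  have "\<exists>k. 0 < Re (pser (c k) (cis t))" if t: "0 < t" "t < 2 * pi" for t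
  proof -
    obtain d where "flat_at_one d" "t \<in> U d" using flat_at_one_at[OF t] by (auto simp: U_def)
    then have "t \<in> \<Union>F" using F(3) by auto
    then obtain d' where d': "d' \<in> G" "t \<in> U d'" using G(3) by auto
    then obtain k where k: "e k = d'" using from_nat_into_surj[OF G'(1), of d'] by (auto simp: e_def G'_def)
    have "pser (c k) (cis t) = of_real (1 / N k) * pser (e k) (cis t)"
      unfolding c_def using e[of k] by (intro pser_scale) (auto simp: flat_at_one_def)
    then have "Re (pser (c k) (cis t)) = (1 / N k) * Re (pser (e k) (cis t))" by simp
    also have "\<dots> > 0" using d'(2) k N[of k] by (intro mult_pos_pos) (auto simp: U_def)
    finally show ?thesis by blast
  qed
  then show ?thesis using g b by blast
qed

section \<open>Density of bounded orbits\<close>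

text \<open>The n-th power of g = exp w, so that n iterations of the adjoint become a single
  \<open>adj_op\<close>.\<close>

definition exp_multiple :: "(nat \<Rightarrow> complex) \<Rightarrow> nat \<Rightarrow> complex \<Rightarrow> complex" where
  "exp_multiple w n z = exp (of_nat n * pser w z)"

lemma holomorphic_on_exp_multiple: "rapid w \<Longrightarrow> exp_multiple w n holomorphic_on ball 0 1"
  unfolding exp_multiple_def[abs_def] by (intro holomorphic_intros holomorphic_on_pser)

lemma continuous_on_exp_multiple: "rapid w \<Longrightarrow> continuous_on (cball 0 1) (exp_multiple w n)"
  unfolding exp_multiple_def[abs_def] by (intro continuous_intros continuous_on_pser)

lemma norm_exp_multiple: "cmod (exp_multiple w n z) = exp (real n * Re (pser w z))"
  by (simp add: exp_multiple_def)

lemma continuous_on_exp_multiple_cis: "rapid w \<Longrightarrow> continuous_on S (\<lambda>t. exp_multiple w n (cis t))"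
  by (rule continuous_on_compose2[OF continuous_on_exp_multiple continuous_on_cis_id]) auto

lemma orbit_arc_coeff:
  assumes w: "rapid w" and \<theta>: "\<theta> \<le> pi" and \<phi>: "continuous_on {-\<theta>..\<theta>} \<phi>"
    and z: "\<And>t. \<bar>t\<bar> \<le> \<theta> \<Longrightarrow> Re (pser w (cis t)) = 0"
  shows "l2_bounded (adj_op (exp_multiple w n) (arc_coeff (-\<theta>) \<theta> \<phi>)) (sqrt (integral {-\<theta>..\<theta>} (\<lambda>t. (cmod (\<phi> t))\<^sup>2) / (2 * pi)))"
proof -
  have "adj_op (exp_multiple w n) (arc_coeff (-\<theta>) \<theta> \<phi>) = arc_coeff (-\<theta>) \<theta> (\<lambda>t. \<phi> t * cnj (exp_multiple w n (cis t)))"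
    by (rule ext) (rule adj_op_arc_coeff[OF holomorphic_on_exp_multiple[OF w] continuous_on_exp_multiple[OF w] _ \<phi>], use \<theta> in simp)
  moreover have "l2_bounded (arc_coeff (-\<theta>) \<theta> (\<lambda>t. \<phi> t * cnj (exp_multiple w n (cis t))))
      (1 * sqrt (integral {-\<theta>..\<theta>} (\<lambda>t. (cmod (\<phi> t))\<^sup>2) / (2 * pi)))"
  proof (rule arc_coeff_mult_le)
    show "continuous_on {-\<theta>..\<theta>} (\<lambda>t. cnj (exp_multiple w n (cis t)))"
      by (intro continuous_intros continuous_on_exp_multiple_cis w)
    show "cmod (cnj (exp_multiple w n (cis t))) \<le> 1" if "t \<in> {-\<theta>..\<theta>}" for t
      using that z[of t] by (simp add: norm_exp_multiple abs_le_iff)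
  qed (use \<theta> \<phi> in auto)
  ultimately show ?thesis by simp
qed

text \<open>Closeness in the l2 norm to coefficient sequences of functions on the arc. The property
  is linear, so density reduces to the unit vectors, and unit vectors already treated can be reused
  inductively.\<close>

definition arc_approximable :: "real \<Rightarrow> (nat \<Rightarrow> complex) \<Rightarrow> bool" where
  "arc_approximable \<theta> x \<longleftrightarrow>
     (\<forall>e>0. \<exists>\<phi>. continuous_on {-\<theta>..\<theta>} \<phi> \<and> l2_bounded (\<lambda>n. x n - arc_coeff (-\<theta>) \<theta> \<phi> n) e)"

lemma arc_approximable_arc_coeff: "continuous_on {-\<theta>..\<theta>} \<phi> \<Longrightarrow> arc_approximable \<theta> (arc_coeff (-\<theta>) \<theta> \<phi>)"
  unfolding arc_approximable_def by (auto intro!: exI[of _ \<phi>] l2_bounded_mono[OF l2_bounded_zero])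

lemma arc_approximable_add:
  assumes "arc_approximable \<theta> x" "arc_approximable \<theta> y"
  shows "arc_approximable \<theta> (\<lambda>n. x n + y n)"
  unfolding arc_approximable_def
proof (intro allI impI)
  fix e :: real assume "e > 0"
  then have e2: "e / 2 > 0" by simp
  obtain \<phi> where \<phi>: "continuous_on {-\<theta>..\<theta>} \<phi>" "l2_bounded (\<lambda>n. x n - arc_coeff (-\<theta>) \<theta> \<phi> n) (e / 2)"
    using assms(1) e2 unfolding arc_approximable_def by blast
  obtain \<psi> where \<psi>: "continuous_on {-\<theta>..\<theta>} \<psi>" "l2_bounded (\<lambda>n. y n - arc_coeff (-\<theta>) \<theta> \<psi> n) (e / 2)"
    using assms(2) e2 unfolding arc_approximable_def by blast
  have "l2_bounded (\<lambda>n. x n + y n - arc_coeff (-\<theta>) \<theta> (\<lambda>t. \<phi> t + \<psi> t) n) e"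
    using l2_bounded_add[OF \<phi>(2) \<psi>(2)] by (simp add: arc_coeff_add \<phi> \<psi> algebra_simps)
  then show "\<exists>\<phi>. continuous_on {-\<theta>..\<theta>} \<phi> \<and> l2_bounded (\<lambda>n. x n + y n - arc_coeff (-\<theta>) \<theta> \<phi> n) e"
    using \<phi>(1) \<psi>(1) by (intro exI[of _ "\<lambda>t. \<phi> t + \<psi> t"]) (auto intro: continuous_on_add)
qed

lemma arc_approximable_scale:
  assumes "arc_approximable \<theta> x"
  shows "arc_approximable \<theta> (\<lambda>n. a * x n)"
  unfolding arc_approximable_def
proof (intro allI impI)
  fix e :: real assume e: "e > 0"
  then have "e / (cmod a + 1) > 0" by (simp add: add_nonneg_pos)
  then obtain \<phi> where \<phi>: "continuous_on {-\<theta>..\<theta>} \<phi>" "l2_bounded (\<lambda>n. x n - arc_coeff (-\<theta>) \<theta> \<phi> n) (e / (cmod a + 1))"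
    using assms(1) unfolding arc_approximable_def by blast
  have "l2_bounded (\<lambda>n. a * (x n - arc_coeff (-\<theta>) \<theta> \<phi> n)) (cmod a * (e / (cmod a + 1)))"
    by (rule l2_bounded_scale) (rule \<phi>)
  moreover have "cmod a * (e / (cmod a + 1)) \<le> e"
  proof -
    have "0 < cmod a + 1" using norm_ge_zero[of a] by linarith
    then show ?thesis using e by (simp add: field_simps)
  qed
  ultimately have "l2_bounded (\<lambda>n. a * x n - arc_coeff (-\<theta>) \<theta> (\<lambda>t. a * \<phi> t) n) e"
    unfolding arc_coeff_scale right_diff_distrib by (rule l2_bounded_mono)
  then show "\<exists>\<phi>. continuous_on {-\<theta>..\<theta>} \<phi> \<and> l2_bounded (\<lambda>n. a * x n - arc_coeff (-\<theta>) \<theta> \<phi> n) e"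
    using \<phi>(1) by (intro exI[of _ "\<lambda>t. a * \<phi> t"]) (auto intro: continuous_intros)
qed

lemma arc_approximable_zero: "arc_approximable \<theta> (\<lambda>n. 0)"
proof -
  have "arc_coeff (-\<theta>) \<theta> (\<lambda>t. 0) = (\<lambda>n. 0)" by (simp add: arc_coeff_def fun_eq_iff)
  then show ?thesis using arc_approximable_arc_coeff[of \<theta> "\<lambda>t. 0"] by simp
qed

lemma arc_approximable_sum:
  assumes "finite I" "\<And>i. i \<in> I \<Longrightarrow> arc_approximable \<theta> (x i)"
  shows "arc_approximable \<theta> (\<lambda>n. \<Sum>i\<in>I. x i n)"
  using assms
proof (induction I rule: finite_induct)
  case empty
  then show ?case by (simp add: arc_approximable_zero)
next
  case (insert i I)
  then show ?case using arc_approximable_add[of \<theta> "x i" "\<lambda>n. \<Sum>i\<in>I. x i n"] by simp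
qed

text \<open>With \<open>Q = exp (N \<psi>)\<close> for a bump \<open>\<psi>\<close> whose real part vanishes off the arc, the adjoint
  Toeplitz operator of \<open>Q\<close> multiplies the top coefficient by \<open>exp N\<close>, while the part of the
  boundary integral off the arc keeps norm at most 1.\<close>

lemma arc_approximable_delta:
  assumes \<theta>: "0 < \<theta>" "\<theta> < pi"
  shows "arc_approximable \<theta> (\<lambda>n. if n = M then 1 else 0)"
proof (induction M rule: less_induct)
  case (less M)
  let ?d = "\<lambda>j n::nat. if n = j then 1 else (0::complex)"
  \<comment> \<open>The parameter is \<theta>/2 because the bump is known to vanish only beyond
    twice its parameter.\<close>
  obtain c where c: "rapid c" "c 0 = 1" "\<And>t. \<theta> \<le> t \<Longrightarrow> t \<le> 2 * pi - \<theta> \<Longrightarrow> Re (pser c (cis t)) = 0"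
    using bump_exists[of "\<theta> / 2"] \<theta> by auto
  show ?case unfolding arc_approximable_def
  proof (intro allI impI)
    fix e :: real assume e: "e > 0"
    \<comment> \<open>This makes exp (-N) at most e / 2, the share of the error reserved for the
      complement of the arc.\<close>
    obtain N :: nat where N: "ln (2 / e) < real N" using reals_Archimedean2 by blast
    define Q where "Q = exp_multiple c N"
    define q where "q = taylor_coeff Q"
    have q0: "q 0 = of_real (exp (real N))"
      by (simp add: q_def Q_def exp_multiple_def pser_0 c exp_of_real of_real_exp)
    have e2: "exp (- real N) \<le> e / 2"
    proof -
      have "2 / e = exp (ln (2 / e))" using e by simp
      also have "\<dots> \<le> exp (real N)" using N by simp
      finally show ?thesis using e by (simp add: exp_minus field_simps)
    qed
    let ?\<psi> = "\<lambda>t. cis (real M * t) * cnj (Q (cis t))"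
    have cQ: "continuous_on S (\<lambda>t. Q (cis t))" for S unfolding Q_def by (rule continuous_on_exp_multiple_cis) (rule c)
    have c\<psi>: "continuous_on S ?\<psi>" for S by (intro continuous_intros cQ)
    define y where "y = arc_coeff \<theta> (2 * pi - \<theta>) ?\<psi>"
    have y: "l2_bounded y 1"
      unfolding y_def
    proof (rule bessel_sup)
      show "cmod (?\<psi> t) \<le> 1" if "t \<in> {\<theta>..2 * pi - \<theta>}" for t
        using that c(3)[of t] by (simp add: norm_mult Q_def norm_exp_multiple)
    qed (use \<theta> c\<psi> in auto)
    \<comment> \<open>The circle integral splits into the arc, which is admissible, and its
      complement, where |Q| = 1 and so \<open>y\<close> has norm at most 1 whatever N is.\<close>
    have key: "adj_op Q (?d M) m = arc_coeff (-\<theta>) \<theta> ?\<psi> m + y m" for m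
    proof -
      have "?d M = arc_coeff (-\<theta>) (2 * pi - \<theta>) (\<lambda>t. cis (real M * t))"
        by (rule ext) (simp add: arc_coeff_circle_cis)
      then have "adj_op Q (?d M) m = adj_op Q (arc_coeff (-\<theta>) (2 * pi - \<theta>) (\<lambda>t. cis (real M * t))) m" by simp
      also have "\<dots> = arc_coeff (-\<theta>) (2 * pi - \<theta>) ?\<psi> m"
        unfolding Q_def by (rule adj_op_arc_coeff) (auto intro!: holomorphic_on_exp_multiple continuous_on_exp_multiple c continuous_intros)
      also have "\<dots> = arc_coeff (-\<theta>) \<theta> ?\<psi> m + y m"
        unfolding y_def by (rule arc_coeff_split) (use \<theta> c\<psi> in auto)
      finally show ?thesis .
    qed
    \<comment> \<open>The entries below the top one are combinations of unit vectors of smaller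
      index; hence the strong induction on M.\<close>
    define x' where "x' = (\<lambda>m. \<Sum>j<M. cnj (q (M - j)) * ?d j m)"
    have x': "adj_op Q (?d M) m = cnj (q 0) * ?d M m + x' m" for m
    proof -
      have "x' m = (\<Sum>j<M. if j = m then cnj (q (M - j)) else 0)" unfolding x'_def by (rule sum.cong) auto
      then have "x' m = (if m < M then cnj (q (M - m)) else 0)" by simp
      then show ?thesis by (auto simp: adj_op_delta q_def)
    qed
    have "arc_approximable \<theta> x'" unfolding x'_def
      by (intro arc_approximable_sum arc_approximable_scale less.IH) auto
    then have "arc_approximable \<theta> (\<lambda>n. (1 / cnj (q 0)) * (arc_coeff (-\<theta>) \<theta> ?\<psi> n + (-1) * x' n))"
      by (intro arc_approximable_scale arc_approximable_add arc_approximable_arc_coeff c\<psi>)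
    moreover have "e / 2 > 0" using e by simp
    ultimately obtain \<phi> where \<phi>: "continuous_on {-\<theta>..\<theta>} \<phi>"
      "l2_bounded (\<lambda>n. (1 / cnj (q 0)) * (arc_coeff (-\<theta>) \<theta> ?\<psi> n + (-1) * x' n) - arc_coeff (-\<theta>) \<theta> \<phi> n) (e / 2)"
      unfolding arc_approximable_def by blast
    have "cmod (1 / cnj (q 0)) = exp (- real N)" by (simp add: q0 norm_divide exp_minus field_simps)
    then have y': "l2_bounded (\<lambda>n. (1 / cnj (q 0)) * y n) (e / 2)"
      using l2_bounded_mono[OF l2_bounded_scale[OF y, of "1 / cnj (q 0)"], of "e / 2"] e2 by simp
    have "q 0 \<noteq> 0" by (simp add: q0)
    \<comment> \<open>Equating the two expressions for the adjoint and dividing by the conjugate of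
      \<open>q 0\<close> shrinks \<open>y\<close> to norm at most exp (-N); the other summands are
      already approximable.\<close>
    then have d: "?d M n = (1 / cnj (q 0)) * (arc_coeff (-\<theta>) \<theta> ?\<psi> n + (-1) * x' n) + (1 / cnj (q 0)) * y n" for n
      using key[of n] x'[of n] by (simp add: field_simps)
    have "l2_bounded (\<lambda>n. ?d M n - arc_coeff (-\<theta>) \<theta> \<phi> n) e"
      using l2_bounded_add[OF \<phi>(2) y'] unfolding d by (simp add: algebra_simps)
    then show "\<exists>\<phi>. continuous_on {-\<theta>..\<theta>} \<phi> \<and> l2_bounded (\<lambda>n. ?d M n - arc_coeff (-\<theta>) \<theta> \<phi> n) e"
      using \<phi>(1) by blast
  qed
qed

lemma arc_approximable_l2_bounded:
  assumes \<theta>: "0 < \<theta>" "\<theta> < pi" and x: "l2_bounded x C"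
  shows "arc_approximable \<theta> x"
  unfolding arc_approximable_def
proof (intro allI impI)
  fix e :: real assume "e > 0"
  then have e2: "e / 2 > 0" by simp
  obtain M where M: "l2_bounded (\<lambda>n. if n < M then 0 else x n) (e / 2)" using l2_bounded_tail[OF x e2] by blast
  have "(\<lambda>n. \<Sum>j<M. x j * (if n = j then 1 else 0)) = (\<lambda>n. if n < M then x n else 0)"
  proof
    fix n
    have "(\<Sum>j<M. x j * (if n = j then 1 else 0)) = (\<Sum>j<M. if j = n then x j else 0)" by (rule sum.cong) auto
    then show "(\<Sum>j<M. x j * (if n = j then 1 else 0)) = (if n < M then x n else 0)" by simp
  qed
  moreover have "arc_approximable \<theta> (\<lambda>n. \<Sum>j<M. x j * (if n = j then 1 else 0))"
    by (intro arc_approximable_sum arc_approximable_scale arc_approximable_delta \<theta>) auto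
  ultimately obtain \<phi> where \<phi>: "continuous_on {-\<theta>..\<theta>} \<phi>"
    "l2_bounded (\<lambda>n. (if n < M then x n else 0) - arc_coeff (-\<theta>) \<theta> \<phi> n) (e / 2)"
    using e2 unfolding arc_approximable_def by metis
  have "(\<lambda>n. (if n < M then x n else 0) - arc_coeff (-\<theta>) \<theta> \<phi> n + (if n < M then 0 else x n)) = (\<lambda>n. x n - arc_coeff (-\<theta>) \<theta> \<phi> n)"
    by auto
  then have "l2_bounded (\<lambda>n. x n - arc_coeff (-\<theta>) \<theta> \<phi> n) e" using l2_bounded_add[OF \<phi>(2) M] by simp
  then show "\<exists>\<phi>. continuous_on {-\<theta>..\<theta>} \<phi> \<and> l2_bounded (\<lambda>n. x n - arc_coeff (-\<theta>) \<theta> \<phi> n) e" using \<phi>(1) by blast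
qed

lemma dense_bounded_orbits:
  assumes w: "flat_at_one w" and x: "l2_bounded x C" and e: "e > 0"
  shows "\<exists>y D. l2_bounded y D \<and> l2_bounded (\<lambda>n. x n - y n) e \<and> (\<forall>n. l2_bounded (adj_op (exp_multiple w n) y) D)"
proof -
  obtain \<theta>0 where \<theta>0: "\<theta>0 > 0" "\<And>t. \<bar>t\<bar> \<le> \<theta>0 \<Longrightarrow> Re (pser w (cis t)) = 0" using w unfolding flat_at_one_def by blast
  \<comment> \<open>The cap at 1 keeps the arc shorter than the full circle, as the approximation
    lemma demands.\<close>
  define \<theta> where "\<theta> = min \<theta>0 1"
  have \<theta>: "0 < \<theta>" "\<theta> < pi" "\<theta> \<le> \<theta>0" using \<theta>0(1) pi_gt3 by (auto simp: \<theta>_def)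
  obtain \<phi> where \<phi>: "continuous_on {-\<theta>..\<theta>} \<phi>" "l2_bounded (\<lambda>n. x n - arc_coeff (-\<theta>) \<theta> \<phi> n) e"
    using arc_approximable_l2_bounded[OF \<theta>(1,2) x] e unfolding arc_approximable_def by blast
  have rw: "rapid w" using w by (simp add: flat_at_one_def)
  have "l2_bounded (arc_coeff (-\<theta>) \<theta> \<phi>) (sqrt (integral {-\<theta>..\<theta>} (\<lambda>t. (cmod (\<phi> t))\<^sup>2) / (2 * pi)))"
    by (rule bessel) (use \<theta> \<phi> in auto)
  moreover have "l2_bounded (adj_op (exp_multiple w n) (arc_coeff (-\<theta>) \<theta> \<phi>)) (sqrt (integral {-\<theta>..\<theta>} (\<lambda>t. (cmod (\<phi> t))\<^sup>2) / (2 * pi)))" for n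
    by (rule orbit_arc_coeff[OF rw _ \<phi>(1)]) (use \<theta> \<theta>0 in auto)
  ultimately show ?thesis using \<phi>(2) by blast
qed

section \<open>The inductive construction\<close>

text \<open>The index n is chosen from \<open>k\<close>, \<open>D\<close> and \<open>q\<close>
  alone, and \<tau> afterwards. The new orbit element splits into the new operator at y' - y, the
  change of the operator at y, and the old orbit element. The first two are made at most 1/2 each,
  whence the margin D + 1.\<close>

lemma orbit_perturbation:
  fixes q :: "real \<Rightarrow> real"
  assumes q: "filterlim q at_top at_top" and w: "rapid w"
    and y: "l2_bounded y D" "\<And>n. l2_bounded (adj_op (exp_multiple w n) y) D"
  shows "\<exists>n\<ge>k. \<exists>\<tau>>0. \<forall>w' y'. rapid w' \<and> (\<forall>z. cmod z < 1 \<longrightarrow> cmod (pser w' z - pser w z) \<le> \<tau>) \<and>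
     l2_bounded (\<lambda>i. y' i - y i) \<tau> \<longrightarrow> (\<exists>D'<q (real n). l2_bounded (adj_op (exp_multiple w' n) y') D')"
proof -
  have "filterlim (\<lambda>n. q (real n)) at_top sequentially"
    by (rule filterlim_compose[OF q filterlim_real_sequentially])
  then have "eventually (\<lambda>n. D + 1 < q (real n)) sequentially" by (simp add: filterlim_at_top_dense)
  then obtain n where n: "n \<ge> k" "D + 1 < q (real n)"
    unfolding eventually_sequentially by (metis nat_le_linear order_refl)
  have D: "0 \<le> D" using y(1) by (rule l2_bounded_nonneg)
  define M where "M = (\<Sum>i. cmod (w i))"
  have M: "cmod (pser w z) \<le> M" if "cmod z < 1" for z using norm_pser_le[OF w, of z] that by (simp add: M_def)
  \<comment> \<open>Chosen so that an operator of norm at most exp (n M) \<epsilon> sends a vector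
    of norm at most D to one of norm at most 1/2; D + 1 avoids a division by 0.\<close>
  define \<epsilon> where "\<epsilon> = 1 / (2 * exp (real n * M) * (D + 1))"
  have \<epsilon>: "0 < \<epsilon>" "exp (real n * M) * \<epsilon> * D \<le> 1 / 2"
  proof -
    show "0 < \<epsilon>" using D by (simp add: \<epsilon>_def)
    have "exp (real n * M) * \<epsilon> * D = D / (2 * (D + 1))" by (simp add: \<epsilon>_def)
    also have "\<dots> \<le> 1 / 2" using D by (simp add: divide_le_eq)
    finally show "exp (real n * M) * \<epsilon> * D \<le> 1 / 2" .
  qed
  have "isCont exp (0::complex)" by simp
  then obtain \<eta> where \<eta>: "\<eta> > 0" "\<And>u::complex. cmod u < \<eta> \<Longrightarrow> cmod (exp u - 1) < \<epsilon>"
    using \<epsilon>(1) unfolding continuous_at_eps_delta by (auto simp: dist_norm)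
  \<comment> \<open>Three demands: w' stays bounded by M + 1, n \<tau> stays below \<eta>, and an
    operator of norm at most exp (n (M + 1)) turns y' - y into a vector of norm at most 1/2.\<close>
  define \<tau> where "\<tau> = min 1 (min (\<eta> / (2 * (real n + 1))) (1 / (2 * exp (real n * (M + 1)))))"
  have \<tau>: "0 < \<tau>" "\<tau> \<le> 1" "\<tau> \<le> \<eta> / (2 * (real n + 1))" "exp (real n * (M + 1)) * \<tau> \<le> 1 / 2"
  proof -
    show "0 < \<tau>" using \<eta>(1) by (simp add: \<tau>_def)
    show "\<tau> \<le> 1" "\<tau> \<le> \<eta> / (2 * (real n + 1))" by (simp_all add: \<tau>_def)
    have "exp (real n * (M + 1)) * \<tau> \<le> exp (real n * (M + 1)) * (1 / (2 * exp (real n * (M + 1))))"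
      by (intro mult_left_mono) (simp_all add: \<tau>_def)
    also have "\<dots> = 1 / 2" by simp
    finally show "exp (real n * (M + 1)) * \<tau> \<le> 1 / 2" .
  qed
  have n\<tau>: "real n * \<tau> < \<eta>"
  proof -
    have "real n * \<tau> \<le> real n * (\<eta> / (2 * (real n + 1)))" using \<tau>(3) by (intro mult_left_mono) auto
    also have "\<dots> < \<eta>" using \<eta>(1) by (simp add: divide_less_eq add_nonneg_pos algebra_simps add_pos_nonneg)
    finally show ?thesis .
  qed
  have "\<exists>D'<q (real n). l2_bounded (adj_op (exp_multiple w' n) y') D'"
    if w': "rapid w'" and ww: "\<And>z. cmod z < 1 \<Longrightarrow> cmod (pser w' z - pser w z) \<le> \<tau>" and yy: "l2_bounded (\<lambda>i. y' i - y i) \<tau>" for w' y'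
  proof -
    have b1: "cmod (exp_multiple w n z) \<le> exp (real n * M)" if "cmod z < 1" for z
      unfolding norm_exp_multiple using M[OF that] abs_Re_le_cmod[of "pser w z"] by (simp add: mult_left_mono)
    have b2: "cmod (exp_multiple w' n z) \<le> exp (real n * (M + 1))" if z: "cmod z < 1" for z
    proof -
      have "cmod (pser w' z) \<le> cmod (pser w z) + cmod (pser w' z - pser w z)" by (metis add.commute norm_triangle_sub)
      then have "Re (pser w' z) \<le> M + 1"
        using M[OF z] ww[OF z] \<tau>(2) complex_Re_le_cmod[of "pser w' z"] by linarith
      then show ?thesis unfolding norm_exp_multiple by (simp add: mult_left_mono)
    qed
    have b3: "cmod (exp_multiple w' n z - exp_multiple w n z) \<le> exp (real n * M) * \<epsilon>" if z: "cmod z < 1" for z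
    proof -
      let ?u = "of_nat n * (pser w' z - pser w z)"
      have "cmod ?u \<le> real n * \<tau>" unfolding norm_mult using ww[OF z] by (simp add: mult_left_mono)
      then have u: "cmod (exp ?u - 1) \<le> \<epsilon>" using n\<tau> \<eta>(2)[of ?u] by simp
      have "exp_multiple w' n z - exp_multiple w n z = exp_multiple w n z * (exp ?u - 1)"
        by (simp add: exp_multiple_def right_diff_distrib exp_add[symmetric])
      then have "cmod (exp_multiple w' n z - exp_multiple w n z) = cmod (exp_multiple w n z) * cmod (exp ?u - 1)"
        by (simp only: norm_mult)
      also have "\<dots> \<le> exp (real n * M) * \<epsilon>" by (intro mult_mono b1 z u) auto
      finally show ?thesis .
    qed
    have h: "exp_multiple w' n holomorphic_on ball 0 1" "exp_multiple w n holomorphic_on ball 0 1"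
      using w w' by (auto intro: holomorphic_on_exp_multiple)
    have y': "l2_bounded y' (\<tau> + D)" using l2_bounded_add[OF yy y(1)] by simp
    have e: "adj_op (exp_multiple w' n) y' m = adj_op (exp_multiple w' n) (\<lambda>i. y' i - y i) m +
        adj_op (\<lambda>z. exp_multiple w' n z - exp_multiple w n z) y m + adj_op (exp_multiple w n) y m" for m
      using adj_op_diff_right[OF h(1) b2 y' y(1), of m] adj_op_diff_left[OF h(1) b2 h(2) b1 y(1), of m] by simp
    have "l2_bounded (adj_op (exp_multiple w' n) (\<lambda>i. y' i - y i)) (exp (real n * (M + 1)) * \<tau>)"
      by (rule adj_op_le[OF h(1) b2 yy])
    moreover have "l2_bounded (adj_op (\<lambda>z. exp_multiple w' n z - exp_multiple w n z) y) (exp (real n * M) * \<epsilon> * D)"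
      by (rule adj_op_le[OF _ b3 y(1)]) (auto intro!: holomorphic_intros h)
    ultimately have "l2_bounded (\<lambda>m. adj_op (exp_multiple w' n) (\<lambda>i. y' i - y i) m + adj_op (\<lambda>z. exp_multiple w' n z - exp_multiple w n z) y m + adj_op (exp_multiple w n) y m)
      (exp (real n * (M + 1)) * \<tau> + exp (real n * M) * \<epsilon> * D + D)"
      by (intro l2_bounded_add y)
    then have "l2_bounded (adj_op (exp_multiple w' n) y') (exp (real n * (M + 1)) * \<tau> + exp (real n * M) * \<epsilon> * D + D)"
      by (simp only: e[symmetric])
    moreover have "exp (real n * (M + 1)) * \<tau> + exp (real n * M) * \<epsilon> * D + D < q (real n)"
      using \<epsilon>(2) \<tau>(4) n(2) by linarith
    ultimately show ?thesis by blast
  qed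
  then show ?thesis using n(1) \<tau>(1) by blast
qed

text \<open>The index n is hidden: a stage hands on only the radius within which its inequality is
  safe. The demand n \<ge> k gives infinitely many indices in the end.\<close>

definition robust :: "(real \<Rightarrow> real) \<Rightarrow> nat \<Rightarrow> (nat \<Rightarrow> complex) \<Rightarrow> (nat \<Rightarrow> complex) \<Rightarrow> real \<Rightarrow> bool" where
  "robust q k w y \<tau> \<longleftrightarrow> (\<exists>n\<ge>k. \<forall>w' y'. rapid w' \<and> (\<forall>z. cmod z < 1 \<longrightarrow> cmod (pser w' z - pser w z) \<le> \<tau>) \<and>
     l2_bounded (\<lambda>i. y' i - y i) \<tau> \<longrightarrow> (\<exists>D<q (real n). l2_bounded (adj_op (exp_multiple w' n) y') D))"

lemma robust_mono: "robust q k w y \<tau> \<Longrightarrow> \<tau>' \<le> \<tau> \<Longrightarrow> robust q k w y \<tau>'"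
  unfolding robust_def by (meson l2_bounded_mono order_trans)

lemma robust_stage:
  assumes q: "filterlim q at_top at_top" and w: "flat_at_one w" and x: "l2_bounded x C" and e: "e > 0"
  shows "\<exists>y \<tau>. (\<exists>D. l2_bounded y D) \<and> l2_bounded (\<lambda>n. x n - y n) e \<and> 0 < \<tau> \<and> \<tau> \<le> e \<and> robust q k w y \<tau>"
proof -
  obtain y D where y: "l2_bounded y D" "l2_bounded (\<lambda>n. x n - y n) e" "\<And>n. l2_bounded (adj_op (exp_multiple w n) y) D"
    using dense_bounded_orbits[OF w x e] by blast
  have rw: "rapid w" using w by (simp add: flat_at_one_def)
  obtain \<tau> where \<tau>: "\<tau> > 0" "robust q k w y \<tau>"
    using orbit_perturbation[OF q rw y(1,3), of k] unfolding robust_def by blast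
  have "robust q k w y (min \<tau> e)" by (rule robust_mono[OF \<tau>(2)]) simp
  then show ?thesis using y \<tau>(1) e by (intro exI[of _ y] exI[of _ "min \<tau> e"]) auto
qed

text \<open>Moves of size \<tau> k / 2 together with the halving of \<tau> keep all later stages
  within \<tau> k of stage k. The vectors start near the unit vector of index 0 so that their limit
  cannot vanish.\<close>

lemma stage_sequences:
  fixes c :: "nat \<Rightarrow> nat \<Rightarrow> complex"
  assumes q: "filterlim q at_top at_top" and c: "\<And>k. flat_at_one (c k)"
  shows "\<exists>a y \<tau>. (\<forall>k. flat_at_one (a k) \<and> (\<exists>D. l2_bounded (y k) D) \<and> 0 < \<tau> k \<and> robust q k (a k) (y k) (\<tau> k) \<and>
      a (Suc k) = (\<lambda>n. a k n + of_real (\<tau> k / 2) * c k n) \<and>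
      l2_bounded (\<lambda>n. y k n - y (Suc k) n) (\<tau> k / 2) \<and> \<tau> (Suc k) \<le> \<tau> k / 2) \<and>
      a 0 = (\<lambda>n. 0) \<and> l2_bounded (\<lambda>n. (if n = 0 then 1 else 0) - y 0 n) (1 / 4) \<and> \<tau> 0 \<le> 1 / 4"
proof -
  \<comment> \<open>The initial data sit in the invariant under k = 0, since dependent choice
    returns only the invariant and the step relation.\<close>
  let ?P = "\<lambda>k (a, y, \<tau>). flat_at_one a \<and> (\<exists>D. l2_bounded y D) \<and> 0 < \<tau> \<and> robust q k a y \<tau> \<and>
     (k = 0 \<longrightarrow> a = (\<lambda>n. 0) \<and> l2_bounded (\<lambda>n. (if n = 0 then 1 else 0) - y n) (1 / 4) \<and> \<tau> \<le> 1 / 4)"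
  let ?Q = "\<lambda>k (a, y, \<tau>) (a', y', \<tau>'). a' = (\<lambda>n. a n + of_real (\<tau> / 2) * c k n) \<and>
      l2_bounded (\<lambda>n. y n - y' n) (\<tau> / 2) \<and> \<tau>' \<le> \<tau> / 2"
  have "\<exists>f. \<forall>k. ?P k (f k) \<and> ?Q k (f k) (f (Suc k))"
  proof (rule dependent_nat_choice)
    obtain y \<tau> where "\<exists>D. l2_bounded y D" "l2_bounded (\<lambda>n. (if n = 0 then 1 else 0) - y n) (1 / 4)" "0 < \<tau>" "\<tau> \<le> 1 / 4"
      "robust q 0 (\<lambda>n. 0) y \<tau>"
      using robust_stage[OF q flat_at_one_zero l2_bounded_delta[of 0], of "1/4" 0] by auto
    then show "\<exists>s. ?P 0 s" using flat_at_one_zero by (intro exI[of _ "(\<lambda>n. 0, y, \<tau>)"]) auto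
  next
    fix s k assume s: "?P k s"
    obtain a y \<tau> where [simp]: "s = (a, y, \<tau>)" by (cases s) auto
    from s obtain D where D: "flat_at_one a" "l2_bounded y D" "0 < \<tau>" by auto
    let ?a = "\<lambda>n. a n + of_real (\<tau> / 2) * c k n"
    have ga: "flat_at_one ?a" using D by (intro flat_at_one_add flat_at_one_scale c) auto
    obtain y' \<tau>' where "\<exists>D. l2_bounded y' D" "l2_bounded (\<lambda>n. y n - y' n) (\<tau> / 2)" "0 < \<tau>'" "\<tau>' \<le> \<tau> / 2" "robust q (Suc k) ?a y' \<tau>'"
      using robust_stage[OF q ga D(2), of "\<tau> / 2" "Suc k"] D(3) by auto
    then show "\<exists>s'. ?P (Suc k) s' \<and> ?Q k s s'" using ga by (intro exI[of _ "(?a, y', \<tau>')"]) auto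
  qed
  then obtain f where f: "\<forall>k. ?P k (f k) \<and> ?Q k (f k) (f (Suc k))" ..
  show ?thesis
    by (rule exI[of _ "\<lambda>k. fst (f k)"], rule exI[of _ "\<lambda>k. fst (snd (f k))"], rule exI[of _ "\<lambda>k. snd (snd (f k))"])
      (use f in \<open>simp add: case_prod_unfold\<close>)
qed

lemma construction:
  fixes q :: "real \<Rightarrow> real"
  assumes q: "filterlim q at_top at_top"
  shows "\<exists>w f C. rapid w \<and> (\<forall>z. cmod z \<le> 1 \<longrightarrow> 0 \<le> Re (pser w z)) \<and> Re (pser w 1) = 0 \<and>
    (\<forall>t. 0 < t \<and> t < 2 * pi \<longrightarrow> 0 < Re (pser w (cis t))) \<and> l2_bounded f C \<and> f 0 \<noteq> 0 \<and>
    (\<forall>k. \<exists>n\<ge>k. \<exists>D<q (real n). l2_bounded (adj_op (exp_multiple w n) f) D)"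
proof -
  obtain c where c: "\<And>k. flat_at_one (c k)" "\<And>k j. j \<le> k \<Longrightarrow> (\<Sum>n. real n ^ j * cmod (c k n)) \<le> 1"
    "\<And>t. 0 < t \<Longrightarrow> t < 2 * pi \<Longrightarrow> \<exists>k. 0 < Re (pser (c k) (cis t))"
    using flat_at_one_family by blast
  obtain a y \<tau> where ay: "\<And>k. flat_at_one (a k)" "\<And>k. \<exists>D. l2_bounded (y k) D" "\<And>k. 0 < \<tau> k" "\<And>k. robust q k (a k) (y k) (\<tau> k)"
    and step: "\<And>k. a (Suc k) = (\<lambda>n. a k n + of_real (\<tau> k / 2) * c k n)"
      "\<And>k. l2_bounded (\<lambda>n. y k n - y (Suc k) n) (\<tau> k / 2)" "\<And>k. \<tau> (Suc k) \<le> \<tau> k / 2"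
    and init: "a 0 = (\<lambda>n. 0)" "l2_bounded (\<lambda>n. (if n = 0 then 1 else 0) - y 0 n) (1 / 4)" "\<tau> 0 \<le> 1 / 4"
    using stage_sequences[OF q, of c] c(1) by blast
  have ra: "rapid (a k)" for k using ay(1)[of k] by (simp add: flat_at_one_def)
  have rc: "rapid (c k)" for k using c(1)[of k] by (simp add: flat_at_one_def)
  \<comment> \<open>Half of \<tau> k is dominated by a telescoping difference, so accumulated
    changes are bounded by \<tau> k - \<tau> (k + j) without summing a geometric series.\<close>
  have dec: "\<tau> k / 2 \<le> \<tau> k - \<tau> (Suc k)" for k using step(3)[of k] by linarith
  have \<tau>0: "\<tau> \<longlonglongrightarrow> 0"
  proof (rule Lim_null_comparison)
    have "\<tau> k \<le> (1 / 2) ^ k" for k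
    proof (induction k)
      case 0 then show ?case using init(3) by simp
    next
      case (Suc k) then show ?case using step(3)[of k] by simp
    qed
    then show "eventually (\<lambda>k. norm (\<tau> k) \<le> (1 / 2) ^ k) sequentially"
      using ay(3) by (auto simp: less_imp_le)
    show "(\<lambda>k. (1 / 2) ^ k :: real) \<longlonglongrightarrow> 0" by (rule LIMSEQ_realpow_zero) auto
  qed
  have ydiff: "l2_bounded (\<lambda>n. y k n - y (k + j) n) (\<tau> k - \<tau> (k + j))" for k j
  proof (induction j)
    case 0 then show ?case by (simp add: l2_bounded_zero)
  next
    case (Suc j)
    from l2_bounded_add[OF Suc l2_bounded_mono[OF step(2)[of "k + j"] dec]] show ?case by simp
  qed
  \<comment> \<open>The bumps are normalised in the norm of order p only from index p on; hence p
    \<le> k.\<close>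
  have adiff: "(\<Sum>n<N. real n ^ p * cmod (a k n - a (k + j) n)) \<le> \<tau> k - \<tau> (k + j)" if "p \<le> k" for k j p N
  proof (induction j)
    case 0 then show ?case by simp
  next
    case (Suc j)
    have "(\<Sum>n<N. real n ^ p * cmod (a k n - a (k + Suc j) n))
      \<le> (\<Sum>n<N. real n ^ p * cmod (a k n - a (k + j) n) + (\<tau> (k + j) / 2) * (real n ^ p * cmod (c (k + j) n)))"
    proof (rule sum_mono)
      fix n
      have "cmod (a k n - a (k + Suc j) n) = cmod ((a k n - a (k + j) n) - of_real (\<tau> (k + j) / 2) * c (k + j) n)"
        by (simp add: step(1) diff_diff_eq)
      also have "\<dots> \<le> cmod (a k n - a (k + j) n) + (\<tau> (k + j) / 2) * cmod (c (k + j) n)"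
        by (rule order_trans[OF norm_triangle_ineq4]) (use ay(3)[of "k + j"] in \<open>simp add: norm_mult\<close>)
      finally have "real n ^ p * cmod (a k n - a (k + Suc j) n)
        \<le> real n ^ p * (cmod (a k n - a (k + j) n) + (\<tau> (k + j) / 2) * cmod (c (k + j) n))"
        by (rule mult_left_mono) simp
      then show "real n ^ p * cmod (a k n - a (k + Suc j) n)
        \<le> real n ^ p * cmod (a k n - a (k + j) n) + (\<tau> (k + j) / 2) * (real n ^ p * cmod (c (k + j) n))"
        by (simp only: distrib_left mult.left_commute)
    qed
    also have "\<dots> = (\<Sum>n<N. real n ^ p * cmod (a k n - a (k + j) n)) + (\<tau> (k + j) / 2) * (\<Sum>n<N. real n ^ p * cmod (c (k + j) n))"
      by (simp only: sum.distrib sum_distrib_left)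
    also have "(\<Sum>n<N. real n ^ p * cmod (c (k + j) n)) \<le> 1"
    proof (rule order_trans[OF sum_le_suminf c(2)])
      show "summable (\<lambda>n. real n ^ p * cmod (c (k + j) n))" using rc by (simp add: rapid_def)
    qed (use that in auto)
    finally have "(\<Sum>n<N. real n ^ p * cmod (a k n - a (k + Suc j) n)) \<le> (\<Sum>n<N. real n ^ p * cmod (a k n - a (k + j) n)) + (\<tau> (k + j) / 2) * 1"
      using ay(3)[of "k + j"] by simp
    then show ?case using Suc dec[of "k + j"] by simp
  qed
  have cauchy_lim: "\<exists>l. X \<longlonglongrightarrow> l" if X: "\<And>k j. cmod (X k - X (k + j)) \<le> \<tau> k" for X :: "nat \<Rightarrow> complex"
  proof -
    have "Cauchy X"
    proof (rule CauchyI')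
      fix e :: real assume "e > 0"
      then obtain k0 where k0: "\<And>k. k \<ge> k0 \<Longrightarrow> \<tau> k < e"
        using order_tendstoD(2)[OF \<tau>0] by (auto simp: eventually_sequentially)
      have "dist (X m) (X n) < e" if "m \<ge> k0" "n > m" for m n
        using X[of m "n - m"] k0[of m] that by (simp add: dist_norm)
      then show "\<exists>M. \<forall>m\<ge>M. \<forall>n>m. dist (X m) (X n) < e" by blast
    qed
    then show ?thesis using Cauchy_convergent convergent_def by blast
  qed
  have "\<exists>l. (\<lambda>k. y k n) \<longlonglongrightarrow> l" for n
    by (rule cauchy_lim) (use l2_bounded_norm_le[OF ydiff] ay(3) in \<open>smt (verit)\<close>)
  then obtain f where f: "\<And>n. (\<lambda>k. y k n) \<longlonglongrightarrow> f n" by metis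
  have "\<exists>l. (\<lambda>k. a k n) \<longlonglongrightarrow> l" for n
  proof (rule cauchy_lim)
    fix k j
    have "cmod (a k n - a (k + j) n) \<le> (\<Sum>n<Suc n. cmod (a k n - a (k + j) n))"
      by (rule member_le_sum) auto
    also have "\<dots> \<le> \<tau> k - \<tau> (k + j)" using adiff[of 0 k j "Suc n"] by simp
    finally show "cmod (a k n - a (k + j) n) \<le> \<tau> k" using ay(3)[of "k + j"] by simp
  qed
  then obtain w where w: "\<And>n. (\<lambda>k. a k n) \<longlonglongrightarrow> w n" by metis
  have fd: "l2_bounded (\<lambda>n. y k n - f n) (\<tau> k)" for k
  proof (rule l2_bounded_limit[where F = sequentially])
    show "(\<lambda>j. y k n - y (k + j) n) \<longlonglongrightarrow> y k n - f n" for n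
      using LIMSEQ_ignore_initial_segment[OF f[of n], of k] by (intro tendsto_intros) (simp add: add.commute)
    show "(\<lambda>j. \<tau> k - \<tau> (k + j)) \<longlonglongrightarrow> \<tau> k"
      using tendsto_diff[OF tendsto_const LIMSEQ_ignore_initial_segment[OF \<tau>0, of k], of "\<tau> k"] by (simp add: add.commute)
  qed (simp_all add: ydiff)
  have wd: "(\<Sum>n<N. real n ^ p * cmod (w n - a k n)) \<le> \<tau> k" if p: "p \<le> k" for k p N
  proof (rule tendsto_upperbound)
    show "(\<lambda>j. \<Sum>n<N. real n ^ p * cmod (a (k + j) n - a k n)) \<longlonglongrightarrow> (\<Sum>n<N. real n ^ p * cmod (w n - a k n))"
      using LIMSEQ_ignore_initial_segment[OF w, of k] by (intro tendsto_intros) (simp add: add.commute)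
    show "eventually (\<lambda>j. (\<Sum>n<N. real n ^ p * cmod (a (k + j) n - a k n)) \<le> \<tau> k) sequentially"
    proof (intro always_eventually allI)
      fix j
      show "(\<Sum>n<N. real n ^ p * cmod (a (k + j) n - a k n)) \<le> \<tau> k"
        using adiff[OF p, of j N] ay(3)[of "k + j"] by (simp add: norm_minus_commute)
    qed
  qed simp
  have swd: "summable (\<lambda>n. real n ^ p * cmod (w n - a k n))" if "p \<le> k" for p k
    by (rule summableI_nonneg_bounded[OF _ wd[OF that]]) simp
  \<comment> \<open>The norm of order p is compared with stage p, from which on the changes are
    controlled in that norm.\<close>
  have rw: "rapid w" unfolding rapid_def
  proof
    fix p
    have "summable (\<lambda>n. real n ^ p * cmod (w n - a p n) + real n ^ p * cmod (a p n))"
      using ra[of p] by (intro summable_add swd) (auto simp: rapid_def)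
    then show "summable (\<lambda>n. real n ^ p * cmod (w n))"
    proof (rule summable_comparison_test'[where N = 0])
      fix n
      have "cmod (w n) \<le> cmod (w n - a p n) + cmod (a p n)" using norm_triangle_ineq[of "w n - a p n" "a p n"] by simp
      then show "norm (real n ^ p * cmod (w n)) \<le> real n ^ p * cmod (w n - a p n) + real n ^ p * cmod (a p n)"
        by (simp add: norm_mult distrib_left[symmetric] mult_left_mono)
    qed
  qed
  have evd: "cmod (pser w z - pser (a k) z) \<le> \<tau> k" if z: "cmod z \<le> 1" for z k
  proof -
    have "(\<lambda>n. (w n - a k n) * z ^ n) sums (pser w z - pser (a k) z)"
      unfolding left_diff_distrib by (intro sums_diff pser_sums rw ra z)
    then have "pser w z - pser (a k) z = (\<Sum>n. (w n - a k n) * z ^ n)" by (rule sums_unique)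
    also have "cmod \<dots> \<le> (\<Sum>n. cmod (w n - a k n))"
      by (rule norm_suminf_le) (use swd[of 0 k] in \<open>auto intro: norm_powser_term_le z\<close>)
    also have "\<dots> \<le> \<tau> k"
      by (rule suminf_le_const) (use swd[of 0 k] wd[of 0 k] in auto)
    finally show ?thesis .
  qed
  have evl: "(\<lambda>k. Re (pser (a k) z)) \<longlonglongrightarrow> Re (pser w z)" if z: "cmod z \<le> 1" for z
  proof (rule tendsto_Re, rule LIM_zero_cancel, rule Lim_null_comparison[OF _ \<tau>0])
    show "eventually (\<lambda>k. norm (pser (a k) z - pser w z) \<le> \<tau> k) sequentially"
      using evd[OF z] by (simp add: norm_minus_commute)
  qed
  \<comment> \<open>Every added bump has nonnegative real part, so real parts increase with the
    stage and positivity once reached is never lost.\<close>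
  have ge: "Re (pser (a k) z) \<le> Re (pser w z)" if z: "cmod z \<le> 1" for z k
  proof (rule incseq_le[OF incseq_SucI evl[OF z]])
    fix k
    have "pser (a (Suc k)) z = pser (a k) z + of_real (\<tau> k / 2) * pser (c k) z"
      unfolding step(1) by (simp only: pser_add pser_scale rapid_scale ra rc z)
    moreover have "0 \<le> Re (of_real (\<tau> k / 2) * pser (c k) z)"
      using c(1)[of k] ay(3)[of k] z by (simp add: flat_at_one_def)
    ultimately show "Re (pser (a k) z) \<le> Re (pser (a (Suc k)) z)" by simp
  qed
  have 1: "0 \<le> Re (pser w z)" if z: "cmod z \<le> 1" for z
    using ge[OF z, of 0] ay(1)[of 0] z by (auto simp: flat_at_one_def intro: order_trans)
  \<comment> \<open>At the point 1 every stage vanishes, although the flat arcs may shrink to that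
    point.\<close>
  have 2: "Re (pser w 1) = 0"
  proof -
    have "Re (pser (a k) 1) = 0" for k
    proof -
      obtain \<theta> where "\<theta> > 0" "\<forall>t. \<bar>t\<bar> \<le> \<theta> \<longrightarrow> Re (pser (a k) (cis t)) = 0"
        using ay(1)[of k] unfolding flat_at_one_def by blast
      then have "Re (pser (a k) (cis 0)) = 0" by (metis abs_zero less_imp_le)
      then show ?thesis by simp
    qed
    then show ?thesis using evl[of 1] by (simp add: LIMSEQ_const_iff)
  qed
  have 3: "0 < Re (pser w (cis t))" if t: "0 < t" "t < 2 * pi" for t
  proof -
    obtain k where k: "0 < Re (pser (c k) (cis t))" using c(3)[OF t] by blast
    have "pser (a (Suc k)) (cis t) = pser (a k) (cis t) + of_real (\<tau> k / 2) * pser (c k) (cis t)"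
      unfolding step(1) by (simp add: pser_add pser_scale rapid_scale ra rc del: of_real_divide)
    moreover have "0 < Re (of_real (\<tau> k / 2) * pser (c k) (cis t))" using ay(3)[of k] k by simp
    moreover have "0 \<le> Re (pser (a k) (cis t))" using ay(1)[of k] by (simp add: flat_at_one_def)
    ultimately have "0 < Re (pser (a (Suc k)) (cis t))" by simp
    also have "\<dots> \<le> Re (pser w (cis t))" by (rule ge) simp
    finally show ?thesis .
  qed
  have 4: "\<exists>C. l2_bounded f C"
  proof -
    obtain D where "l2_bounded (y 0) D" using ay(2) by blast
    from l2_bounded_diff[OF this fd[of 0]] show ?thesis by auto
  qed
  \<comment> \<open>The entry moves by at most 1/4 on passing to \<open>y 0\<close> and by at most
    \<tau> 0 \<le> 1/4 from there to the limit, starting from 1.\<close>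
  have 5: "f 0 \<noteq> 0"
  proof -
    have "cmod (1 - y 0 0) \<le> 1 / 4" using l2_bounded_norm_le[OF init(2), of 0] by simp
    moreover have "cmod (y 0 0 - f 0) \<le> 1 / 4" using l2_bounded_norm_le[OF fd[of 0], of 0] init(3) by simp
    moreover have "cmod (1 - f 0) \<le> cmod (1 - y 0 0) + cmod (y 0 0 - f 0)"
      using norm_triangle_ineq[of "1 - y 0 0" "y 0 0 - f 0"] by simp
    ultimately have "cmod (1 - f 0) < 1" by linarith
    then show ?thesis by auto
  qed
  \<comment> \<open>The limits lie in the safe ball of every stage, so each stage contributes its
    own index.\<close>
  have 6: "\<exists>n\<ge>k. \<exists>D<q (real n). l2_bounded (adj_op (exp_multiple w n) f) D" for k
  proof -
    have "l2_bounded (\<lambda>i. f i - y k i) (\<tau> k)" using l2_bounded_scale[OF fd[of k], of "-1"] by simp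
    moreover have "\<forall>z. cmod z < 1 \<longrightarrow> cmod (pser w z - pser (a k) z) \<le> \<tau> k" using evd by simp
    ultimately show ?thesis using ay(4)[of k] rw unfolding robust_def by blast
  qed
  show ?thesis using rw 1 2 3 4 5 6 by blast
qed

section \<open>Smoothness on the boundary\<close>

text \<open>The formal j-th derivative of the boundary function in the angle; one differentiation,
  proved for all j together, then yields every order.\<close>

definition angular_deriv :: "(nat \<Rightarrow> complex) \<Rightarrow> nat \<Rightarrow> real \<Rightarrow> complex" where
  "angular_deriv w j t = (\<Sum>n. (\<i> * of_nat n) ^ j * w n * cis (real n * t))"

lemma norm_angular_deriv_term: "cmod ((\<i> * of_nat n) ^ j * w n * cis (real n * t)) = real n ^ j * cmod (w n)"
  by (simp add: norm_mult norm_power)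

lemma has_vector_derivative_angular_deriv:
  assumes w: "rapid w"
  shows "(angular_deriv w j has_vector_derivative angular_deriv w (Suc j) t) (at t)"
proof -
  let ?f = "\<lambda>j n t. (\<i> * of_nat n) ^ j * w n * cis (real n * t)"
  have sm: "summable (\<lambda>n. real n ^ j * cmod (w n))" for j using w by (simp add: rapid_def)
  have sums: "(\<lambda>n. ?f j n t) sums angular_deriv w j t" for j t
    unfolding angular_deriv_def by (intro summable_sums summable_comparison_test'[OF sm[of j], of 0]) (simp only: norm_angular_deriv_term)
  have ul: "uniform_limit UNIV (\<lambda>N t. \<Sum>n<N. ?f (Suc j) n t) (angular_deriv w (Suc j)) sequentially"
    unfolding angular_deriv_def by (rule Weierstrass_m_test[OF _ sm[of "Suc j"]]) (simp only: norm_angular_deriv_term)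
  have "\<exists>g. \<forall>t\<in>UNIV. (\<lambda>n. ?f j n t) sums g t \<and> (g has_derivative (\<lambda>h. h *\<^sub>R angular_deriv w (Suc j) t)) (at t within UNIV)"
  proof (rule has_derivative_series)
    fix n and t :: real
    have "((\<lambda>z. (\<i> * of_nat n) ^ j * w n * exp (\<i> * (of_nat n * z))) has_field_derivative
        (\<i> * of_nat n) ^ j * w n * (exp (\<i> * (of_nat n * of_real t)) * (\<i> * of_nat n))) (at (of_real t))"
      by (auto intro!: derivative_eq_intros)
    from has_vector_derivative_real_field[OF this]
    have "(?f j n has_vector_derivative ?f (Suc j) n t) (at t)"
      by (simp add: cis_conv_exp mult_ac)
    then show "(?f j n has_derivative (\<lambda>h. h *\<^sub>R ?f (Suc j) n t)) (at t within UNIV)"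
      by (simp only: has_vector_derivative_def)
  next
    fix e :: real assume e: "e > 0"
    have "eventually (\<lambda>N. \<forall>t\<in>UNIV. dist (\<Sum>n<N. ?f (Suc j) n t) (angular_deriv w (Suc j) t) < e) sequentially"
      using ul e unfolding uniform_limit_iff by blast
    then show "eventually (\<lambda>N. \<forall>t\<in>UNIV. \<forall>h. norm ((\<Sum>n<N. h *\<^sub>R ?f (Suc j) n t) - h *\<^sub>R angular_deriv w (Suc j) t) \<le> e * norm h) sequentially"
    proof eventually_elim
      case (elim N)
      show ?case
      proof (intro ballI allI)
        fix t h :: real
        have "(\<Sum>n<N. h *\<^sub>R ?f (Suc j) n t) - h *\<^sub>R angular_deriv w (Suc j) t = h *\<^sub>R ((\<Sum>n<N. ?f (Suc j) n t) - angular_deriv w (Suc j) t)"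
          by (simp only: scaleR_diff_right scaleR_sum_right)
        then have "norm ((\<Sum>n<N. h *\<^sub>R ?f (Suc j) n t) - h *\<^sub>R angular_deriv w (Suc j) t) = norm h * dist (\<Sum>n<N. ?f (Suc j) n t) (angular_deriv w (Suc j) t)"
          by (simp only: norm_scaleR dist_norm real_norm_def)
        also have "\<dots> \<le> norm h * e" by (rule mult_left_mono) (use elim in \<open>auto intro: less_imp_le simp del: power_Suc\<close>)
        finally show "norm ((\<Sum>n<N. h *\<^sub>R ?f (Suc j) n t) - h *\<^sub>R angular_deriv w (Suc j) t) \<le> e * norm h" by (simp only: mult.commute)
      qed
    qed
  next
    show "(\<lambda>n. ?f j n 0) sums angular_deriv w j 0" by (rule sums)
  qed auto
  then obtain g where g: "\<And>t. (\<lambda>n. ?f j n t) sums g t" "\<And>t. (g has_derivative (\<lambda>h. h *\<^sub>R angular_deriv w (Suc j) t)) (at t)"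
    by auto
  \<comment> \<open>Differentiation of series only provides some sum function; uniqueness of sums
    identifies it.\<close>
  have "g = angular_deriv w j" using sums_unique2[OF g(1) sums] by blast
  then show ?thesis using g(2) by (simp only: has_vector_derivative_def)
qed

lemma angular_deriv_0: "angular_deriv w 0 t = pser w (cis t)"
  by (simp add: angular_deriv_def pser_def Complex.DeMoivre)

text \<open>Contains the boundary function of exp w and is closed under differentiation, so all
  iterated derivatives exist without an explicit formula for them.\<close>

inductive_set smooth_algebra :: "(nat \<Rightarrow> complex) \<Rightarrow> (real \<Rightarrow> complex) set" for w where
  angular_deriv: "angular_deriv w j \<in> smooth_algebra w"
| exp: "(\<lambda>t. exp (angular_deriv w 0 t)) \<in> smooth_algebra w"
| add: "f \<in> smooth_algebra w \<Longrightarrow> g \<in> smooth_algebra w \<Longrightarrow> (\<lambda>t. f t + g t) \<in> smooth_algebra w"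
| mult: "f \<in> smooth_algebra w \<Longrightarrow> g \<in> smooth_algebra w \<Longrightarrow> (\<lambda>t. f t * g t) \<in> smooth_algebra w"

lemma smooth_algebra_derivative:
  assumes w: "rapid w" and f: "f \<in> smooth_algebra w"
  shows "\<exists>f'\<in>smooth_algebra w. \<forall>t. (f has_vector_derivative f' t) (at t)"
  using f
proof induction
  case (angular_deriv j)
  show ?case by (rule bexI[of _ "angular_deriv w (Suc j)"]) (auto intro: has_vector_derivative_angular_deriv w smooth_algebra.angular_deriv)
next
  case exp
  have "((\<lambda>t. exp (angular_deriv w 0 t)) has_vector_derivative angular_deriv w 1 t * exp (angular_deriv w 0 t)) (at t)" for t
    using field_vector_diff_chain_at[OF has_vector_derivative_angular_deriv[OF w, of 0 t] DERIV_exp] by (simp add: o_def)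
  then show ?case
    by (intro bexI[of _ "\<lambda>t. angular_deriv w 1 t * exp (angular_deriv w 0 t)"]) (auto intro: smooth_algebra.intros)
next
  case (add f g)
  then obtain f' g' where "f' \<in> smooth_algebra w" "g' \<in> smooth_algebra w"
    "\<forall>t. (f has_vector_derivative f' t) (at t)" "\<forall>t. (g has_vector_derivative g' t) (at t)" by blast
  then show ?case
    by (intro bexI[of _ "\<lambda>t. f' t + g' t"]) (auto intro: smooth_algebra.add has_vector_derivative_add)
next
  case (mult f g)
  then obtain f' g' where "f' \<in> smooth_algebra w" "g' \<in> smooth_algebra w"
    "\<forall>t. (f has_vector_derivative f' t) (at t)" "\<forall>t. (g has_vector_derivative g' t) (at t)" by blast
  with mult show ?case
    by (intro bexI[of _ "\<lambda>t. f t * g' t + f' t * g t"])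
      (auto intro!: smooth_algebra.add smooth_algebra.mult has_vector_derivative_mult)
qed

lemma C_infinity_exp_pser:
  assumes w: "rapid w"
  shows "C_infinity (\<lambda>t. exp (pser w (cis t)))"
proof -
  have "(vderiv ^^ k) (\<lambda>t. exp (pser w (cis t))) \<in> smooth_algebra w" for k
  proof (induction k)
    case 0
    show ?case using smooth_algebra.exp[of w] by (simp add: angular_deriv_0)
  next
    case (Suc k)
    then obtain f' where f': "f' \<in> smooth_algebra w"
      "\<And>t. ((vderiv ^^ k) (\<lambda>t. exp (pser w (cis t))) has_vector_derivative f' t) (at t)"
      using smooth_algebra_derivative[OF w] by blast
    have "vderiv ((vderiv ^^ k) (\<lambda>t. exp (pser w (cis t)))) = f'"
    proof
      fix t
      show "vderiv ((vderiv ^^ k) (\<lambda>t. exp (pser w (cis t)))) t = f' t"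
        by (subst vderiv_def) (rule vector_derivative_at[OF f'(2)])
    qed
    then show ?case using f'(1) by simp
  qed
  then show ?thesis unfolding C_infinity_def
    using smooth_algebra_derivative[OF w] differentiableI_vector by blast
qed

section \<open>Toeplitz operators and their adjoints\<close>

lemma H2_l2_bounded: "h \<in> H2 \<Longrightarrow> l2_bounded (taylor_coeff h) (H2_norm h)"
  unfolding H2_def H2_norm_def by (auto intro: summable_l2_bounded)

lemma pser_l2_bounded:
  assumes "l2_bounded x C"
  shows "pser x \<in> H2" "taylor_coeff (pser x) = x"
proof -
  have s: "(\<lambda>n. x n * z ^ n) sums pser x z" if "cmod z < 1" for z
    unfolding pser_def by (intro summable_sums summable_bounded_powser[where B = C] l2_bounded_norm_le[OF assms] that)
  show t: "taylor_coeff (pser x) = x" by (rule taylor_unique(2)[OF s])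
  have "pser x holomorphic_on ball 0 1" by (rule taylor_unique(1)[OF s])
  then show "pser x \<in> H2" using l2_bounded_summable[OF assms] by (simp add: H2_def t)
qed

lemma taylor_coeff_mult:
  assumes u: "u holomorphic_on ball 0 1" and g: "g holomorphic_on ball 0 1"
  shows "taylor_coeff (\<lambda>z. g z * u z) n = (\<Sum>k\<le>n. taylor_coeff u k * taylor_coeff g (n - k))"
proof -
  have "(\<lambda>n. (\<Sum>k\<le>n. taylor_coeff u k * taylor_coeff g (n - k)) * z ^ n) sums (g z * u z)" if z: "cmod z < 1" for z
  proof -
    have sm: "summable (\<lambda>n. norm (taylor_coeff h n * z ^ n))" if "h holomorphic_on ball 0 1" for h
      using taylor_abs_summable[OF that, of "cmod z"] z by (simp add: norm_mult norm_power)
    have "(\<lambda>n. \<Sum>k\<le>n. (taylor_coeff u k * z ^ k) * (taylor_coeff g (n - k) * z ^ (n - k))) sums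
        ((\<Sum>n. taylor_coeff u n * z ^ n) * (\<Sum>n. taylor_coeff g n * z ^ n))"
      by (rule Cauchy_product_sums[OF sm[OF u] sm[OF g]])
    also have "(\<Sum>n. taylor_coeff u n * z ^ n) = u z" by (rule sums_unique[symmetric, OF taylor_sums[OF u z]])
    also have "(\<Sum>n. taylor_coeff g n * z ^ n) = g z" by (rule sums_unique[symmetric, OF taylor_sums[OF g z]])
    also have "(\<lambda>n. \<Sum>k\<le>n. (taylor_coeff u k * z ^ k) * (taylor_coeff g (n - k) * z ^ (n - k)))
      = (\<lambda>n. (\<Sum>k\<le>n. taylor_coeff u k * taylor_coeff g (n - k)) * z ^ n)"
    proof
      fix n
      have "(taylor_coeff u k * z ^ k) * (taylor_coeff g (n - k) * z ^ (n - k)) = taylor_coeff u k * taylor_coeff g (n - k) * z ^ n"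
        if "k \<le> n" for k
      proof -
        have "z ^ n = z ^ k * z ^ (n - k)" using that by (simp add: power_add[symmetric])
        then show ?thesis by (simp only: mult_ac)
      qed
      then show "(\<Sum>k\<le>n. (taylor_coeff u k * z ^ k) * (taylor_coeff g (n - k) * z ^ (n - k)))
        = (\<Sum>k\<le>n. taylor_coeff u k * taylor_coeff g (n - k)) * z ^ n"
        unfolding sum_distrib_right by (intro sum.cong refl) simp
    qed
    finally show ?thesis by (simp only: mult.commute[of "u z"])
  qed
  from taylor_unique(2)[OF this] show ?thesis by (rule fun_cong)
qed

text \<open>The double series of products of coefficients of u, g and h need not converge
  absolutely, so the sums cannot simply be interchanged. The N-th partial sum runs over the triangle
  k + j < N and is a pairing with the adjoint of the truncated h; the truncation error is at most
  the norm of u times K times the norm of the tail of h. Convergence and value come out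
  together.\<close>

lemma toeplitz_adjoint_sums:
  assumes g: "g holomorphic_on ball 0 1" "\<And>z. cmod z < 1 \<Longrightarrow> cmod (g z) \<le> K"
    and u: "u \<in> H2" and h: "h \<in> H2"
  shows "(\<lambda>n. taylor_coeff (toeplitz g u) n * cnj (taylor_coeff h n)) sums
    (\<Sum>k. taylor_coeff u k * cnj (adj_op g (taylor_coeff h) k))"
proof -
  let ?U = "taylor_coeff u" and ?H = "taylor_coeff h"
  let ?v = "adj_op g ?H"
  let ?HN = "\<lambda>N n. if n < N then ?H n else 0"
  have lu: "l2_bounded ?U (H2_norm u)" and lh: "l2_bounded ?H (H2_norm h)" using u h by (auto intro: H2_l2_bounded)
  have lv: "l2_bounded ?v (K * H2_norm h)" by (rule adj_op_le[OF g lh])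
  have partial: "(\<Sum>n<N. taylor_coeff (toeplitz g u) n * cnj (?H n)) = (\<Sum>k<N. ?U k * cnj (adj_op g (?HN N) k))" for N
  proof -
    have hu: "u holomorphic_on ball 0 1" using u by (simp add: H2_def)
    let ?F = "\<lambda>k j. ?U k * taylor_coeff g j * cnj (?H (k + j))"
    have "(\<Sum>n<N. taylor_coeff (toeplitz g u) n * cnj (?H n)) = (\<Sum>n<N. \<Sum>k\<le>n. ?F k (n - k))"
      unfolding toeplitz_def taylor_coeff_mult[OF hu g(1)] sum_distrib_right
      by (intro sum.cong refl) simp
    also have "\<dots> = (\<Sum>(k, j)\<in>{(k, j). k + j < N}. ?F k j)" by (rule sum.triangle_reindex[symmetric])
    also have "\<dots> = (\<Sum>(k, j)\<in>{..<N} \<times> {..<N}. if k + j < N then ?F k j else 0)"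
      by (rule sum.mono_neutral_cong_left) (auto split: if_splits)
    also have "\<dots> = (\<Sum>k<N. \<Sum>j<N. if k + j < N then ?F k j else 0)" by (rule sum.cartesian_product[symmetric])
    also have "\<dots> = (\<Sum>k<N. ?U k * cnj (adj_op g (?HN N) k))"
    proof (rule sum.cong[OF refl])
      fix k
      have "adj_op g (?HN N) k = (\<Sum>j<N. cnj (taylor_coeff g j) * ?HN N (k + j))" by (rule adj_op_finite) auto
      then have "?U k * cnj (adj_op g (?HN N) k) = (\<Sum>j<N. ?U k * (taylor_coeff g j * cnj (?HN N (k + j))))"
        by (simp add: sum_distrib_left)
      also have "\<dots> = (\<Sum>j<N. if k + j < N then ?F k j else 0)" by (rule sum.cong) auto
      finally show "(\<Sum>j<N. if k + j < N then ?F k j else 0) = ?U k * cnj (adj_op g (?HN N) k)" by simp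
    qed
    finally show ?thesis .
  qed
  have diff: "(\<lambda>N. (\<Sum>k<N. ?U k * cnj (adj_op g (?HN N) k)) - (\<Sum>k<N. ?U k * cnj (?v k))) \<longlonglongrightarrow> 0"
  proof (rule LIMSEQ_I)
    fix r :: real assume r: "r > 0"
    \<comment> \<open>The summand 1 keeps B positive even if u or K is 0.\<close>
    define B where "B = H2_norm u * K + 1"
    have K: "0 \<le> K" using g(2)[of 0] norm_ge_zero[of "g 0"] by (simp del: norm_ge_zero)
    have B: "B \<ge> 1" unfolding B_def using l2_bounded_nonneg[OF lu] K by simp
    obtain M where M: "\<And>N. N \<ge> M \<Longrightarrow> l2_bounded (\<lambda>n. if n < N then 0 else ?H n) (r / (2 * B))"
      using l2_bounded_tail[OF lh, of "r / (2 * B)"] r B by auto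
    have "norm ((\<Sum>k<N. ?U k * cnj (adj_op g (?HN N) k)) - (\<Sum>k<N. ?U k * cnj (?v k)) - 0) < r" if N: "N \<ge> M" for N
    proof -
      have d: "adj_op g (\<lambda>n. ?HN N n - ?H n) = (\<lambda>k. adj_op g (?HN N) k - ?v k)"
        by (rule ext) (rule adj_op_diff_right[OF g l2_bounded_truncate[OF lh] lh])
      have l: "l2_bounded (\<lambda>n. ?HN N n - ?H n) (r / (2 * B))"
      proof -
        have "(\<lambda>n. (-1) * (if n < N then 0 else ?H n)) = (\<lambda>n. ?HN N n - ?H n)" by auto
        then show ?thesis using l2_bounded_scale[OF M[OF N], of "-1"] by simp
      qed
      have l': "l2_bounded (\<lambda>k. adj_op g (?HN N) k - ?v k) (K * (r / (2 * B)))"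
        unfolding d[symmetric] by (rule adj_op_le[OF g l])
      have "norm ((\<Sum>k<N. ?U k * cnj (adj_op g (?HN N) k)) - (\<Sum>k<N. ?U k * cnj (?v k)) - 0) = norm (\<Sum>k<N. ?U k * cnj (adj_op g (?HN N) k - ?v k))"
        by (simp add: sum_subtractf[symmetric] right_diff_distrib)
      also have "\<dots> \<le> (\<Sum>k<N. cmod (?U k) * cmod (adj_op g (?HN N) k - ?v k))"
        by (rule order_trans[OF norm_sum]) (simp add: norm_mult complex_cnj_diff[symmetric] del: complex_cnj_diff)
      also have "\<dots> \<le> H2_norm u * (K * (r / (2 * B)))" by (rule l2_bounded_mult_sum_le[OF lu l'])
      also have "\<dots> = (H2_norm u * K) * (r / (2 * B))" by simp
      also have "\<dots> \<le> B * (r / (2 * B))" by (rule mult_right_mono) (use r B in \<open>auto simp: B_def\<close>)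
      also have "\<dots> < r" using r B by simp
      finally show ?thesis .
    qed
    then show "\<exists>M. \<forall>N\<ge>M. norm ((\<Sum>k<N. ?U k * cnj (adj_op g (?HN N) k)) - (\<Sum>k<N. ?U k * cnj (?v k)) - 0) < r" by blast
  qed
  have "summable (\<lambda>k. ?U k * cnj (?v k))"
    by (rule summable_norm_cancel) (use l2_bounded_mult_summable[OF lu lv] in \<open>simp add: norm_mult\<close>)
  from tendsto_add[OF diff summable_LIMSEQ[OF this]] show ?thesis
    unfolding sums_def partial by simp
qed

text \<open>Existence keeps the later claim about every adjoint \<open>A\<close> from being
  vacuous.\<close>

lemma toeplitz_adjoint_exists:
  assumes g: "g holomorphic_on ball 0 1" "\<And>z. cmod z < 1 \<Longrightarrow> cmod (g z) \<le> K"
  shows "is_toeplitz_adjoint g (\<lambda>h. pser (adj_op g (taylor_coeff h)))"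
  unfolding is_toeplitz_adjoint_def
proof (intro conjI ballI)
  fix h assume h: "h \<in> H2"
  have l: "l2_bounded (adj_op g (taylor_coeff h)) (K * H2_norm h)" by (rule adj_op_le[OF g H2_l2_bounded[OF h]])
  show "pser (adj_op g (taylor_coeff h)) \<in> H2" by (rule pser_l2_bounded(1)[OF l])
  fix u assume u: "u \<in> H2"
  show "H2_inner (toeplitz g u) h = H2_inner u (pser (adj_op g (taylor_coeff h)))"
    unfolding H2_inner_def pser_l2_bounded(2)[OF l] by (rule sums_unique[symmetric, OF toeplitz_adjoint_sums[OF g u h]])
qed

lemma bounded_holomorphic_H2:
  assumes "g holomorphic_on ball 0 1" "\<And>z. cmod z < 1 \<Longrightarrow> cmod (g z) \<le> K"
  shows "g \<in> H2"
  using l2_bounded_summable[OF l2_bounded_taylor[OF assms]] assms(1) by (simp add: H2_def)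

lemma taylor_coeff_power: "taylor_coeff (\<lambda>z. z ^ m) = (\<lambda>n. if n = m then 1 else 0)"
proof (rule taylor_unique(2))
  fix z :: complex
  have "(\<lambda>n. if n = m then z ^ m else 0) sums z ^ m" by (rule sums_single)
  moreover have "(\<lambda>n. if n = m then z ^ m else 0) = (\<lambda>n. (if n = m then 1 else 0) * z ^ n)" by auto
  ultimately show "(\<lambda>n. (if n = m then 1 else 0) * z ^ n) sums z ^ m" by simp
qed

text \<open>\<open>A\<close> is any function satisfying the adjoint relation, with no linearity
  assumed. Iterating the relation moves all n factors g to the test function, and testing with z^m
  reads off the m-th coefficient.\<close>

lemma toeplitz_adjoint_power:
  assumes A: "is_toeplitz_adjoint g A" and f: "f \<in> H2"
    and g: "g holomorphic_on ball 0 1" "\<And>z. cmod z < 1 \<Longrightarrow> cmod (g z) \<le> K"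
  shows "(A ^^ n) f \<in> H2" "taylor_coeff ((A ^^ n) f) = adj_op (\<lambda>z. g z ^ n) (taylor_coeff f)"
proof -
  show H: "(A ^^ n) f \<in> H2" for n
    by (induction n) (use A f in \<open>auto simp: is_toeplitz_adjoint_def\<close>)
  \<comment> \<open>Multiplication by g keeps bounded test functions bounded, hence in H^2; the
    bound L therefore varies along the induction.\<close>
  have inner: "H2_inner (\<lambda>z. g z ^ n * u z) f = H2_inner u ((A ^^ n) f)"
    if "u holomorphic_on ball 0 1" "\<And>z. cmod z < 1 \<Longrightarrow> cmod (u z) \<le> L" for u L
    using that
  proof (induction n arbitrary: u L)
    case 0
    then show ?case by simp
  next
    case (Suc n)
    have b: "cmod (g z * u z) \<le> K * L" if "cmod z < 1" for z
      unfolding norm_mult using g(2)[OF that] Suc.prems(2)[OF that] by (meson mult_mono norm_ge_zero order_trans)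
    have "H2_inner u ((A ^^ Suc n) f) = H2_inner (toeplitz g u) ((A ^^ n) f)"
      using A bounded_holomorphic_H2[OF Suc.prems] H[of n] by (simp add: is_toeplitz_adjoint_def)
    also have "\<dots> = H2_inner (\<lambda>z. g z ^ n * (g z * u z)) f"
      unfolding toeplitz_def by (rule Suc.IH[symmetric, OF _ b]) (auto intro!: holomorphic_intros g Suc.prems)
    also have "(\<lambda>z. g z ^ n * (g z * u z)) = (\<lambda>z. g z ^ Suc n * u z)" by (simp add: mult_ac)
    finally show ?case by simp
  qed
  have gn: "(\<lambda>z. g z ^ n) holomorphic_on ball 0 1" "\<And>z. cmod z < 1 \<Longrightarrow> cmod (g z ^ n) \<le> K ^ n"
    by (auto intro!: holomorphic_intros g power_mono simp: norm_power)
  show "taylor_coeff ((A ^^ n) f) = adj_op (\<lambda>z. g z ^ n) (taylor_coeff f)"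
  proof
    fix m
    have pow: "(\<lambda>z::complex. z ^ m) holomorphic_on ball 0 1" "\<And>z::complex. cmod z < 1 \<Longrightarrow> cmod (z ^ m) \<le> 1"
      by (auto intro!: holomorphic_intros power_le_one simp: norm_power)
    have single: "(\<Sum>k. (if k = m then 1 else 0) * cnj (x k)) = cnj (x m)" for x :: "nat \<Rightarrow> complex"
      by (subst suminf_finite[of "{m}"]) auto
    have "cnj (taylor_coeff ((A ^^ n) f) m) = H2_inner (\<lambda>z. z ^ m) ((A ^^ n) f)"
      by (simp only: H2_inner_def taylor_coeff_power single)
    also have "\<dots> = H2_inner (toeplitz (\<lambda>z. g z ^ n) (\<lambda>z. z ^ m)) f"
      unfolding toeplitz_def by (rule inner[symmetric, OF pow])
    also have "\<dots> = (\<Sum>k. taylor_coeff (\<lambda>z. z ^ m) k * cnj (adj_op (\<lambda>z. g z ^ n) (taylor_coeff f) k))"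
      unfolding H2_inner_def
      by (rule sums_unique[symmetric, OF toeplitz_adjoint_sums[OF gn bounded_holomorphic_H2[OF pow] f]])
    also have "\<dots> = cnj (adj_op (\<lambda>z. g z ^ n) (taylor_coeff f) m)" by (simp only: taylor_coeff_power single)
    finally show "taylor_coeff ((A ^^ n) f) m = adj_op (\<lambda>z. g z ^ n) (taylor_coeff f) m" by simp
  qed
qed

theorem theorem6p4:
  fixes q :: "real \<Rightarrow> real"
  assumes "mono_on {0<..} q"
    and "\<forall>x>0. q x > 0"
    and "filterlim q at_top at_top"
  shows "\<exists>g G f.
     g \<in> Hinf \<and>
     g ` ball 0 1 \<inter> ball 0 1 = {} \<and>
     (\<forall>z. cmod z = 1 \<longrightarrow> ((\<lambda>r. g (complex_of_real r * z)) \<longlongrightarrow> G z) (at_left 1)) \<and>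
     C_infinity (\<lambda>t. G (cis t)) \<and>
     (\<forall>z. cmod z = 1 \<longrightarrow> (cmod (G z) = 1 \<longleftrightarrow> z = 1)) \<and>
     f \<in> H2 \<and> (\<exists>z\<in>ball 0 1. f z \<noteq> 0) \<and>
     (\<exists>A. is_toeplitz_adjoint g A) \<and>
     (\<forall>A. is_toeplitz_adjoint g A \<longrightarrow>
        (\<exists>\<^sub>\<infinity>n. H2_norm ((A ^^ n) f) < q (real n)))"
proof -
  obtain w x C where w: "rapid w" "\<And>z. cmod z \<le> 1 \<Longrightarrow> 0 \<le> Re (pser w z)" "Re (pser w 1) = 0"
      "\<And>t. 0 < t \<Longrightarrow> t < 2 * pi \<Longrightarrow> 0 < Re (pser w (cis t))"
    and x: "l2_bounded x C" "x 0 \<noteq> 0" "\<And>k. \<exists>n\<ge>k. \<exists>D<q (real n). l2_bounded (adj_op (exp_multiple w n) x) D"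
    using construction[OF assms(3)] by blast
  \<comment> \<open>The series converges on the closed disc, so the same function also serves as its
    boundary function \<open>G\<close>.\<close>
  define g where "g = (\<lambda>z. exp (pser w z))"
  have gh: "g holomorphic_on ball 0 1" unfolding g_def by (intro holomorphic_intros holomorphic_on_pser w)
  have gb: "cmod (g z) \<le> exp (\<Sum>n. cmod (w n))" if "cmod z < 1" for z
    using norm_pser_le[OF w(1), of z] complex_Re_le_cmod[of "pser w z"] that by (simp add: g_def)
  have gn: "(\<lambda>z. g z ^ n) = exp_multiple w n" for n
    by (rule ext) (simp add: g_def exp_multiple_def exp_of_nat_mult)
  have 1: "g \<in> Hinf" using gh gb unfolding Hinf_def bounded_iff by fastforce
  have "1 \<le> cmod (g z)" if "cmod z < 1" for z using w(2)[of z] that by (simp add: g_def)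
  then have 2: "g ` ball 0 1 \<inter> ball 0 1 = {}" by (auto simp: not_less[symmetric])
  have 3: "((\<lambda>r. g (complex_of_real r * z)) \<longlongrightarrow> g z) (at_left 1)" if "cmod z = 1" for z
    unfolding g_def by (intro tendsto_exp pser_radial w) (simp add: that)
  have 4: "C_infinity (\<lambda>t. g (cis t))" unfolding g_def by (rule C_infinity_exp_pser) (rule w)
  have 5: "cmod (g z) = 1 \<longleftrightarrow> z = 1" if z: "cmod z = 1" for z
  proof (cases "z = 1")
    case True
    then show ?thesis using w(3) by (simp add: g_def)
  next
    case False
    \<comment> \<open>The argument in [0, 2 pi) is 0 only for z = 1; every other boundary point
      falls in the open interval where the real part is positive.\<close>
    have zt: "z = cis (Arg2pi z)" using z complex_norm_eq_1_exp[of z] by (simp add: cis_conv_exp)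
    have "Arg2pi z \<noteq> 0" using zt False by (metis cis_zero)
    then have "0 < Re (pser w (cis (Arg2pi z)))" using Arg2pi_ge_0[of z] Arg2pi_lt_2pi[of z] by (intro w(4)) auto
    then show ?thesis using False zt by (simp add: g_def)
  qed
  have 6: "\<exists>z\<in>ball 0 1. pser x z \<noteq> 0" using x(2) by (intro bexI[of _ 0]) (auto simp: pser_def)
  have 7: "\<exists>\<^sub>\<infinity>n. H2_norm ((A ^^ n) (pser x)) < q (real n)" if A: "is_toeplitz_adjoint g A" for A
    unfolding INFM_nat_le
  proof
    fix k
    obtain n D where n: "n \<ge> k" "D < q (real n)" "l2_bounded (adj_op (exp_multiple w n) x) D" using x(3)[of k] by blast
    have "taylor_coeff ((A ^^ n) (pser x)) = adj_op (exp_multiple w n) x"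
      using toeplitz_adjoint_power(2)[OF A pser_l2_bounded(1)[OF x(1)] gh gb, of n] by (simp only: gn pser_l2_bounded(2)[OF x(1)])
    then have "H2_norm ((A ^^ n) (pser x)) \<le> D" using l2_bounded_suminf_le[OF n(3)] by (simp add: H2_norm_def)
    then show "\<exists>n\<ge>k. H2_norm ((A ^^ n) (pser x)) < q (real n)" using n by (intro exI[of _ n]) auto
  qed
  have "\<exists>A. is_toeplitz_adjoint g A" using toeplitz_adjoint_exists[OF gh gb] by blast
  then show ?thesis
    by (intro exI[of _ g] exI[of _ "pser x"] conjI allI impI 1 2 4 6 pser_l2_bounded(1)[OF x(1)]) (auto intro: 3 7 simp: 5)
qed

end
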